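(* Let $\Sigma$ and $\Gamma$ be arbitrary classes of structures (not necessarily list types). Let $B_0 \in \Gamma$ be a fixed structure (the initial state) and let $\delta : \Gamma \times \Sigma \to \Gamma$ be a quantifier-free interpretation. Then the function $\Sigma^* \to \Gamma$ obtained by folding, i.e. $[A_1,\ldots,A_n] \mapsto B_n$ where $B_i = \delta(B_{i-1}, A_i)$ for $i = 1,\ldots,n$, is a linear MSO interpretation.
   Context: A vocabulary is a finite set of relation names with arities in $\{0,1,\ldots\}$ (nullary relations allowed); a structure consists of a finite, possibly empty, universe and an interpretation of the vocabulary. A class of structures consists of structures over one vocabulary and is closed under isomorphism. Constructions on classes: the class $\Sigma_1 \times \Sigma_2$ has as vocabulary the disjoint union of the two vocabularies plus a new unary relation; its structures are disjoint unions of a structure of $\Sigma_1$ and one of $\Sigma_2$, with the unary relation selecting the elements coming from the first one. The class $\Sigma^*$ consists of structures obtained from a list $[A_1,\ldots,A_n]$ of nonempty structures of $\Sigma$ by taking their disjoint union, adding a binary relation $x \le y$ which holds iff the list item containing $x$ appears no later than the one containing $y$, and replacing every nullary relation $R()$ of $\Sigma$ by a unary relation $R(x)$ selecting the elements whose list item satisfies $R()$. A polynomial functor is an operation on sets of the form $F(A) = A^{k_1} + \cdots + A^{k_n}$; each $A^{k_i}$ is a component of dimension $k_i$. An MSO query of type $F$ is a family of MSO formulas, one per component, the formula for component $A^{k_i}$ having $k_i$ free variables. A function $f : \Sigma \to \Gamma$ between classes of structures is an MSO interpretation if there is a polynomial functor $F$ such that (1) there is an MSO query of type $F$ which, evaluated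 in every input structure $A$, defines the universe of $f(A)$ as a subset of $F(A)$; and (2) for every relation name of arity $m$ of the output vocabulary there is an MSO query of type $F^m = F \times \cdots \times F$ ($m$ times, again a polynomial functor) defining that relation in $f(A)$. It is linear if all components of $F$ have dimension at most one. A quantifier-free interpretation is an MSO interpretation whose functor is the identity $F(A) = A$ and all of whose formulas are quantifier-free. *)

theory Defs
  imports Main "HOL-Library.Nat_Bijection"
begin

section \<open>Structures and classes of structures\<close>

type_synonym 'r vocabulary = "'r \<rightharpoonup> nat"

record ('r, 'a) rel_structure =
  universe :: "'a set"
  interp :: "'r \<Rightarrow> 'a list set"

definition is_structure :: "'r vocabulary \<Rightarrow> ('r, 'a) rel_structure \<Rightarrow> bool" where
  "is_structure voc S \<longleftrightarrow> finite (universe S) \<and>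
     (\<forall>r. \<forall>xs \<in> interp S r. set xs \<subseteq> universe S \<and> voc r = Some (length xs))"

definition isomorphic :: "('r, 'a) rel_structure \<Rightarrow> ('r, 'b) rel_structure \<Rightarrow> bool" (infix "\<cong>" 50) where
  "S \<cong> T \<longleftrightarrow> (\<exists>h. bij_betw h (universe S) (universe T) \<and>
     (\<forall>r xs. set xs \<subseteq> universe S \<longrightarrow> (xs \<in> interp S r \<longleftrightarrow> map h xs \<in> interp T r)))"

definition map_structure :: "('a \<Rightarrow> 'b) \<Rightarrow> ('r, 'a) rel_structure \<Rightarrow> ('r, 'b) rel_structure" where
  "map_structure h S = \<lparr>universe = h ` universe S, interp = (\<lambda>r. map h ` interp S r)\<rparr>"

text \<open>
  Structures are finite, so every structure has an isomorphic copy whose elements are natural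
  numbers. A class is represented by its members of this kind.
\<close>

record 'r struct_class =
  voc :: "'r vocabulary"
  members :: "('r, nat) rel_structure set"

definition is_class :: "'r struct_class \<Rightarrow> bool" where
  "is_class \<Sigma> \<longleftrightarrow> finite (dom (voc \<Sigma>)) \<and>
     (\<forall>S \<in> members \<Sigma>. is_structure (voc \<Sigma>) S) \<and>
     (\<forall>S \<in> members \<Sigma>. \<forall>T. is_structure (voc \<Sigma>) T \<and> S \<cong> T \<longrightarrow> T \<in> members \<Sigma>)"


section \<open>Products and lists\<close>

datatype ('r, 's) prod_name = Fst_Name 'r | Snd_Name 's | Is_Fst

fun prod_voc :: "'r vocabulary \<Rightarrow> 's vocabulary \<Rightarrow> ('r, 's) prod_name vocabulary" where
  "prod_voc v w (Fst_Name r) = v r"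
| "prod_voc v w (Snd_Name s) = w s"
| "prod_voc v w Is_Fst = Some 1"

fun pair_interp ::
  "('r, 'a) rel_structure \<Rightarrow> ('s, 'b) rel_structure \<Rightarrow> ('r, 's) prod_name \<Rightarrow> ('a + 'b) list set" where
  "pair_interp A B (Fst_Name r) = map Inl ` interp A r"
| "pair_interp A B (Snd_Name s) = map Inr ` interp B s"
| "pair_interp A B Is_Fst = {[Inl x] | x. x \<in> universe A}"

definition pair_structure ::
  "('r, 'a) rel_structure \<Rightarrow> ('s, 'b) rel_structure \<Rightarrow> (('r, 's) prod_name, 'a + 'b) rel_structure" where
  "pair_structure A B = \<lparr>universe = universe A <+> universe B, interp = pair_interp A B\<rparr>"

definition prod_class ::
  "'r struct_class \<Rightarrow> 's struct_class \<Rightarrow> ('r, 's) prod_name struct_class" where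
  "prod_class \<Sigma>1 \<Sigma>2 =
     \<lparr>voc = prod_voc (voc \<Sigma>1) (voc \<Sigma>2),
      members = {S. is_structure (prod_voc (voc \<Sigma>1) (voc \<Sigma>2)) S \<and>
        (\<exists>A \<in> members \<Sigma>1. \<exists>B \<in> members \<Sigma>2. pair_structure A B \<cong> S)}\<rparr>"

datatype 'r list_name = Item_Name 'r | Precedes

fun list_voc :: "'r vocabulary \<Rightarrow> 'r list_name vocabulary" where
  "list_voc v (Item_Name r) = (case v r of None \<Rightarrow> None | Some k \<Rightarrow> Some (if k = 0 then 1 else k))"
| "list_voc v Precedes = Some 2"

definition list_universe :: "('r, 'a) rel_structure list \<Rightarrow> (nat \<times> 'a) set" where
  "list_universe As = {(i, x). i < length As \<and> x \<in> universe (As ! i)}"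

fun list_interp ::
  "'r vocabulary \<Rightarrow> ('r, 'a) rel_structure list \<Rightarrow> 'r list_name \<Rightarrow> (nat \<times> 'a) list set" where
  "list_interp v As (Item_Name r) =
     (if v r = Some 0
      then {[(i, x)] | i x. (i, x) \<in> list_universe As \<and> [] \<in> interp (As ! i) r}
      else {map (Pair i) xs | i xs. i < length As \<and> xs \<in> interp (As ! i) r})"
| "list_interp v As Precedes =
     {[(i, x), (j, y)] | i x j y.
        (i, x) \<in> list_universe As \<and> (j, y) \<in> list_universe As \<and> i \<le> j}"

definition list_structure ::
  "'r vocabulary \<Rightarrow> ('r, 'a) rel_structure list \<Rightarrow> ('r list_name, nat \<times> 'a) rel_structure" where
  "list_structure v As = \<lparr>universe = list_universe As, interp = list_interp v As\<rparr>"

definition item_list :: "'r struct_class \<Rightarrow> ('r, nat) rel_structure list \<Rightarrow> bool" where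
  "item_list \<Sigma> As \<longleftrightarrow> (\<forall>A \<in> set As. A \<in> members \<Sigma> \<and> universe A \<noteq> {})"

definition list_class :: "'r struct_class \<Rightarrow> 'r list_name struct_class" where
  "list_class \<Sigma> =
     \<lparr>voc = list_voc (voc \<Sigma>),
      members = {S. is_structure (list_voc (voc \<Sigma>)) S \<and>
        (\<exists>As. item_list \<Sigma> As \<and> list_structure (voc \<Sigma>) As \<cong> S)}\<rparr>"


section \<open>Monadic second-order logic\<close>

datatype 'r mso =
    Falsum
  | Equal nat nat
  | Atom 'r "nat list"
  | Member nat nat
  | Neg "'r mso"
  | Conj "'r mso" "'r mso"
  | Ex nat "'r mso"
  | ExSet nat "'r mso"

primrec sat :: "('r, 'a) rel_structure \<Rightarrow> (nat \<Rightarrow> 'a) \<Rightarrow> (nat \<Rightarrow> 'a set) \<Rightarrow> 'r mso \<Rightarrow> bool" where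
  "sat S v V Falsum \<longleftrightarrow> False"
| "sat S v V (Equal x y) \<longleftrightarrow> v x = v y"
| "sat S v V (Atom r xs) \<longleftrightarrow> map v xs \<in> interp S r"
| "sat S v V (Member x X) \<longleftrightarrow> v x \<in> V X"
| "sat S v V (Neg \<phi>) \<longleftrightarrow> \<not> sat S v V \<phi>"
| "sat S v V (Conj \<phi> \<psi>) \<longleftrightarrow> sat S v V \<phi> \<and> sat S v V \<psi>"
| "sat S v V (Ex x \<phi>) \<longleftrightarrow> (\<exists>a \<in> universe S. sat S (v(x := a)) V \<phi>)"
| "sat S v V (ExSet X \<phi>) \<longleftrightarrow> (\<exists>A. A \<subseteq> universe S \<and> sat S v (V(X := A)) \<phi>)"

primrec free_fo :: "'r mso \<Rightarrow> nat set" where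
  "free_fo Falsum = {}"
| "free_fo (Equal x y) = {x, y}"
| "free_fo (Atom r xs) = set xs"
| "free_fo (Member x X) = {x}"
| "free_fo (Neg \<phi>) = free_fo \<phi>"
| "free_fo (Conj \<phi> \<psi>) = free_fo \<phi> \<union> free_fo \<psi>"
| "free_fo (Ex x \<phi>) = free_fo \<phi> - {x}"
| "free_fo (ExSet X \<phi>) = free_fo \<phi>"

primrec free_so :: "'r mso \<Rightarrow> nat set" where
  "free_so Falsum = {}"
| "free_so (Equal x y) = {}"
| "free_so (Atom r xs) = {}"
| "free_so (Member x X) = {X}"
| "free_so (Neg \<phi>) = free_so \<phi>"
| "free_so (Conj \<phi> \<psi>) = free_so \<phi> \<union> free_so \<psi>"
| "free_so (Ex x \<phi>) = free_so \<phi>"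
| "free_so (ExSet X \<phi>) = free_so \<phi> - {X}"

primrec over_voc :: "'r vocabulary \<Rightarrow> 'r mso \<Rightarrow> bool" where
  "over_voc v Falsum \<longleftrightarrow> True"
| "over_voc v (Equal x y) \<longleftrightarrow> True"
| "over_voc v (Atom r xs) \<longleftrightarrow> v r = Some (length xs)"
| "over_voc v (Member x X) \<longleftrightarrow> True"
| "over_voc v (Neg \<phi>) \<longleftrightarrow> over_voc v \<phi>"
| "over_voc v (Conj \<phi> \<psi>) \<longleftrightarrow> over_voc v \<phi> \<and> over_voc v \<psi>"
| "over_voc v (Ex x \<phi>) \<longleftrightarrow> over_voc v \<phi>"
| "over_voc v (ExSet X \<phi>) \<longleftrightarrow> over_voc v \<phi>"

primrec quantifier_free :: "'r mso \<Rightarrow> bool" where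
  "quantifier_free Falsum \<longleftrightarrow> True"
| "quantifier_free (Equal x y) \<longleftrightarrow> True"
| "quantifier_free (Atom r xs) \<longleftrightarrow> True"
| "quantifier_free (Member x X) \<longleftrightarrow> True"
| "quantifier_free (Neg \<phi>) \<longleftrightarrow> quantifier_free \<phi>"
| "quantifier_free (Conj \<phi> \<psi>) \<longleftrightarrow> quantifier_free \<phi> \<and> quantifier_free \<psi>"
| "quantifier_free (Ex x \<phi>) \<longleftrightarrow> False"
| "quantifier_free (ExSet X \<phi>) \<longleftrightarrow> False"

text \<open>
  The \<open>k\<close> free variables of a formula are the first-order variables \<open>0, \<dots>, k - 1\<close>.
\<close>

definition formula_with :: "'r vocabulary \<Rightarrow> nat \<Rightarrow> 'r mso \<Rightarrow> bool" where
  "formula_with v k \<phi> \<longleftrightarrow> over_voc v \<phi> \<and> free_fo \<phi> \<subseteq> {..<k} \<and> free_so \<phi> = {}"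

definition holds :: "('r, 'a) rel_structure \<Rightarrow> 'a list \<Rightarrow> 'r mso \<Rightarrow> bool" where
  "holds S xs \<phi> \<longleftrightarrow> sat S (\<lambda>i. xs ! i) (\<lambda>_. {}) \<phi>"


section \<open>Polynomial functors, queries and interpretations\<close>

record 'i poly_functor =
  components :: "'i set"
  dimension :: "'i \<Rightarrow> nat"

definition functor_apply :: "'i poly_functor \<Rightarrow> 'a set \<Rightarrow> ('i \<times> 'a list) set" where
  "functor_apply F A = {(i, xs). i \<in> components F \<and> length xs = dimension F i \<and> set xs \<subseteq> A}"

definition id_functor :: "nat poly_functor" where
  "id_functor = \<lparr>components = {0}, dimension = (\<lambda>_. 1)\<rparr>"

text \<open>
  Distributing products over sums, the components of \<open>F\<^sup>m\<close> are the \<open>m\<close>-tuples of components of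
  \<open>F\<close>, and their dimensions add up. The map \<open>flatten\<close> identifies \<open>F(A)\<^sup>m\<close> with \<open>F\<^sup>m(A)\<close>.
\<close>

definition functor_power :: "'i poly_functor \<Rightarrow> nat \<Rightarrow> 'i list poly_functor" where
  "functor_power F m =
     \<lparr>components = {cs. length cs = m \<and> set cs \<subseteq> components F},
      dimension = (\<lambda>cs. sum_list (map (dimension F) cs))\<rparr>"

definition flatten :: "('i \<times> 'a list) list \<Rightarrow> 'i list \<times> 'a list" where
  "flatten es = (map fst es, concat (map snd es))"

type_synonym ('i, 'r) query = "'i \<Rightarrow> 'r mso"

definition is_query :: "'r vocabulary \<Rightarrow> 'i poly_functor \<Rightarrow> ('i, 'r) query \<Rightarrow> bool" where
  "is_query v F q \<longleftrightarrow> (\<forall>i \<in> components F. formula_with v (dimension F i) (q i))"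

definition query_result ::
  "'i poly_functor \<Rightarrow> ('i, 'r) query \<Rightarrow> ('r, 'a) rel_structure \<Rightarrow> ('i \<times> 'a list) set" where
  "query_result F q S = {(i, xs) \<in> functor_apply F (universe S). holds S xs (q i)}"

record ('r, 's) mso_interp =
  ifunctor :: "nat poly_functor"
  universe_query :: "(nat, 'r) query"
  relation_query :: "'s \<Rightarrow> (nat list, 'r) query"

definition is_interpretation ::
  "'r vocabulary \<Rightarrow> 's vocabulary \<Rightarrow> ('r, 's) mso_interp \<Rightarrow> bool" where
  "is_interpretation v w I \<longleftrightarrow>
     finite (components (ifunctor I)) \<and>
     is_query v (ifunctor I) (universe_query I) \<and>
     (\<forall>s m. w s = Some m \<longrightarrow> is_query v (functor_power (ifunctor I) m) (relation_query I s))"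

definition interpreted ::
  "'s vocabulary \<Rightarrow> ('r, 's) mso_interp \<Rightarrow> ('r, 'a) rel_structure \<Rightarrow>
     ('s, nat \<times> 'a list) rel_structure" where
  "interpreted w I S =
     (let U = query_result (ifunctor I) (universe_query I) S in
      \<lparr>universe = U,
       interp = (\<lambda>s. {es. w s = Some (length es) \<and> set es \<subseteq> U \<and>
         flatten es \<in>
           query_result (functor_power (ifunctor I) (length es)) (relation_query I s) S})\<rparr>)"

text \<open>Functions between classes of structures are considered up to isomorphism.\<close>

definition realizes ::
  "('r, 's) mso_interp \<Rightarrow> 'r struct_class \<Rightarrow> 's struct_class \<Rightarrow>
     (('r, nat) rel_structure \<Rightarrow> ('s, nat) rel_structure) \<Rightarrow> bool" where
  "realizes I \<Sigma> \<Gamma> f \<longleftrightarrow>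
     is_interpretation (voc \<Sigma>) (voc \<Gamma>) I \<and>
     (\<forall>A \<in> members \<Sigma>. f A \<in> members \<Gamma> \<and> f A \<cong> interpreted (voc \<Gamma>) I A)"

definition linear_mso_interpretation ::
  "'r struct_class \<Rightarrow> 's struct_class \<Rightarrow> (('r, nat) rel_structure \<Rightarrow> ('s, nat) rel_structure) \<Rightarrow> bool" where
  "linear_mso_interpretation \<Sigma> \<Gamma> f \<longleftrightarrow>
     (\<exists>I. realizes I \<Sigma> \<Gamma> f \<and>
       (\<forall>i \<in> components (ifunctor I). dimension (ifunctor I) i \<le> 1))"

definition quantifier_free_interpretation ::
  "'r struct_class \<Rightarrow> 's struct_class \<Rightarrow> (('r, nat) rel_structure \<Rightarrow> ('s, nat) rel_structure) \<Rightarrow> bool" where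
  "quantifier_free_interpretation \<Sigma> \<Gamma> f \<longleftrightarrow>
     (\<exists>I. realizes I \<Sigma> \<Gamma> f \<and> ifunctor I = id_functor \<and>
       (\<forall>i \<in> components id_functor. quantifier_free (universe_query I i)) \<and>
       (\<forall>s m. voc \<Gamma> s = Some m \<longrightarrow>
         (\<forall>cs \<in> components (functor_power id_functor m). quantifier_free (relation_query I s cs))))"


section \<open>Folding\<close>

definition pair_nat ::
  "('r, nat) rel_structure \<Rightarrow> ('s, nat) rel_structure \<Rightarrow> (('r, 's) prod_name, nat) rel_structure" where
  "pair_nat A B = map_structure sum_encode (pair_structure A B)"

definition fold_list ::
  "((('s, 'r) prod_name, nat) rel_structure \<Rightarrow> ('s, nat) rel_structure) \<Rightarrow> ('s, nat) rel_structure \<Rightarrow>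
     ('r, nat) rel_structure list \<Rightarrow> ('s, nat) rel_structure" where
  "fold_list \<delta> B0 As = foldl (\<lambda>B A. \<delta> (pair_nat B A)) B0 As"

text \<open>
  A structure in \<open>list_class \<Sigma>\<close> determines the list it is obtained from up to isomorphism of
  the items, so the result does not depend on the chosen list; see \<open>fold_function_list\<close> below.
\<close>

definition fold_function ::
  "'r struct_class \<Rightarrow> ((('s, 'r) prod_name, nat) rel_structure \<Rightarrow> ('s, nat) rel_structure) \<Rightarrow>
     ('s, nat) rel_structure \<Rightarrow> ('r list_name, nat) rel_structure \<Rightarrow> ('s, nat) rel_structure" where
  "fold_function \<Sigma> \<delta> B0 S =
     fold_list \<delta> B0 (SOME As. item_list \<Sigma> As \<and> list_structure (voc \<Sigma>) As \<cong> S)"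


section \<open>Well-definedness\<close>

definition iso_map :: "('a \<Rightarrow> 'b) \<Rightarrow> ('r, 'a) rel_structure \<Rightarrow> ('r, 'b) rel_structure \<Rightarrow> bool" where
  "iso_map h S T \<longleftrightarrow> bij_betw h (universe S) (universe T) \<and>
     (\<forall>r xs. set xs \<subseteq> universe S \<longrightarrow> (xs \<in> interp S r \<longleftrightarrow> map h xs \<in> interp T r))"

lemma isomorphic_iff: "S \<cong> T \<longleftrightarrow> (\<exists>h. iso_map h S T)"
  by (simp add: isomorphic_def iso_map_def)

lemma isomorphic_refl: "S \<cong> S"
  unfolding isomorphic_iff iso_map_def by (rule exI[of _ id]) auto

lemma isomorphic_sym:
  assumes "S \<cong> T"
  shows "T \<cong> S"
proof -
  obtain h where h: "iso_map h S T"
    using assms by (auto simp: isomorphic_iff)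
  let ?g = "inv_into (universe S) h"
  have b: "bij_betw h (universe S) (universe T)"
    using h by (simp add: iso_map_def)
  have g: "bij_betw ?g (universe T) (universe S)"
    using b by (rule bij_betw_inv_into)
  have "ys \<in> interp T r \<longleftrightarrow> map ?g ys \<in> interp S r" if "set ys \<subseteq> universe T" for r ys
  proof -
    have "map h (map ?g ys) = ys"
      using that bij_betw_inv_into_right[OF b] by (auto simp: map_idI subset_iff)
    moreover have "set (map ?g ys) \<subseteq> universe S"
      using that bij_betwE[OF g] by auto
    ultimately show ?thesis
      using h by (metis iso_map_def)
  qed
  with g show ?thesis
    unfolding isomorphic_iff iso_map_def by blast
qed

lemma isomorphic_trans:
  assumes "S \<cong> T" "T \<cong> U"
  shows "S \<cong> U"
proof -
  obtain h k where h: "iso_map h S T" and k: "iso_map k T U"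
    using assms by (auto simp: isomorphic_iff)
  have "bij_betw (k \<circ> h) (universe S) (universe U)"
    using h k by (auto simp: iso_map_def intro: bij_betw_trans)
  moreover have "xs \<in> interp S r \<longleftrightarrow> map (k \<circ> h) xs \<in> interp U r"
    if "set xs \<subseteq> universe S" for r xs
  proof -
    have "set (map h xs) \<subseteq> universe T"
      using that h bij_betwE[of h "universe S" "universe T"] by (auto simp: iso_map_def)
    then have "map h xs \<in> interp T r \<longleftrightarrow> map k (map h xs) \<in> interp U r"
      using k unfolding iso_map_def by blast
    moreover have "xs \<in> interp S r \<longleftrightarrow> map h xs \<in> interp T r"
      using h that unfolding iso_map_def by blast
    ultimately show ?thesis
      by simp
  qed
  ultimately show ?thesis
    unfolding isomorphic_iff iso_map_def by blast
qed

lemma map_structure_isomorphic: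
  assumes "inj h"
  shows "S \<cong> map_structure h S"
  unfolding isomorphic_iff iso_map_def
proof (intro exI[of _ h] conjI allI impI)
  show "bij_betw h (universe S) (universe (map_structure h S))"
    using assms by (auto simp: map_structure_def bij_betw_def intro: inj_on_subset)
  show "xs \<in> interp S r \<longleftrightarrow> map h xs \<in> interp (map_structure h S) r" for r xs
    using assms inj_map_eq_map[of h] by (auto simp: map_structure_def)
qed

lemma is_structure_map_structure:
  "is_structure v S \<Longrightarrow> is_structure v (map_structure h S)"
  by (fastforce simp: is_structure_def map_structure_def)

lemma is_structure_pair_structure:
  assumes "is_structure v A" "is_structure w B"
  shows "is_structure (prod_voc v w) (pair_structure A B)"
  unfolding is_structure_def
proof (intro conjI allI ballI)
  show "finite (universe (pair_structure A B))"
    using assms by (simp add: is_structure_def pair_structure_def)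
next
  fix r xs
  assume "xs \<in> interp (pair_structure A B) r"
  then show "set xs \<subseteq> universe (pair_structure A B)" "prod_voc v w r = Some (length xs)"
    using assms by (cases r; fastforce simp: is_structure_def pair_structure_def)+
qed

lemma finite_list_universe:
  assumes "\<And>A. A \<in> set As \<Longrightarrow> finite (universe A)"
  shows "finite (list_universe As)"
proof -
  have "list_universe As = Sigma {..<length As} (\<lambda>i. universe (As ! i))"
    by (auto simp: list_universe_def)
  then show ?thesis
    using assms by (auto intro!: finite_SigmaI)
qed

lemma is_structure_list_structure:
  assumes "\<And>A. A \<in> set As \<Longrightarrow> is_structure v A"
  shows "is_structure (list_voc v) (list_structure v As)"
  unfolding is_structure_def
proof (intro conjI allI ballI)
  show "finite (universe (list_structure v As))"
    using assms by (auto simp: list_structure_def is_structure_def intro: finite_list_universe)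
next
  fix r xs
  assume xs: "xs \<in> interp (list_structure v As) r"
  have A: "set ys \<subseteq> universe (As ! i)" "v s = Some (length ys)"
    if "i < length As" "ys \<in> interp (As ! i) s" for i s ys
    using assms[of "As ! i"] that by (auto simp: is_structure_def)
  show "set xs \<subseteq> universe (list_structure v As)"
    using xs A(1)
    by (cases r) (fastforce simp: list_structure_def list_universe_def split: if_splits)+
  show "list_voc v r = Some (length xs)"
    using xs A(2) by (cases r) (fastforce simp: list_structure_def split: if_splits)+
qed

lemma is_class_structure: "is_class \<Sigma> \<Longrightarrow> S \<in> members \<Sigma> \<Longrightarrow> is_structure (voc \<Sigma>) S"
  by (simp add: is_class_def)

lemma is_class_prod_class:
  assumes "is_class \<Sigma>1" "is_class \<Sigma>2"
  shows "is_class (prod_class \<Sigma>1 \<Sigma>2)"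
proof -
  have "r \<in> insert Is_Fst (Fst_Name ` dom (voc \<Sigma>1) \<union> Snd_Name ` dom (voc \<Sigma>2))"
    if "r \<in> dom (prod_voc (voc \<Sigma>1) (voc \<Sigma>2))" for r
    using that by (cases r) auto
  then have "dom (prod_voc (voc \<Sigma>1) (voc \<Sigma>2)) \<subseteq> insert Is_Fst (Fst_Name ` dom (voc \<Sigma>1) \<union> Snd_Name ` dom (voc \<Sigma>2))"
    by blast
  moreover have "finite (insert Is_Fst (Fst_Name ` dom (voc \<Sigma>1) \<union> Snd_Name ` dom (voc \<Sigma>2)))"
    using assms by (simp add: is_class_def)
  ultimately have "finite (dom (prod_voc (voc \<Sigma>1) (voc \<Sigma>2)))"
    by (rule finite_subset)
  then show ?thesis
    by (auto simp: is_class_def prod_class_def) (meson isomorphic_trans)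
qed

lemma is_class_list_class:
  assumes "is_class \<Sigma>"
  shows "is_class (list_class \<Sigma>)"
proof -
  have "r \<in> insert Precedes (Item_Name ` dom (voc \<Sigma>))" if "r \<in> dom (list_voc (voc \<Sigma>))" for r
    using that by (cases r) (auto split: option.splits)
  then have "dom (list_voc (voc \<Sigma>)) \<subseteq> insert Precedes (Item_Name ` dom (voc \<Sigma>))"
    by blast
  moreover have "finite (insert Precedes (Item_Name ` dom (voc \<Sigma>)))"
    using assms by (simp add: is_class_def)
  ultimately have "finite (dom (list_voc (voc \<Sigma>)))"
    by (rule finite_subset)
  then show ?thesis
    by (auto simp: is_class_def list_class_def) (meson isomorphic_trans)
qed

lemma pair_nat_isomorphic: "pair_structure A B \<cong> pair_nat A B"
  unfolding pair_nat_def
  by (rule map_structure_isomorphic) (simp add: inj_sum_encode)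

lemma pair_nat_in_prod_class:
  assumes "is_class \<Sigma>1" "is_class \<Sigma>2" "A \<in> members \<Sigma>1" "B \<in> members \<Sigma>2"
  shows "pair_nat A B \<in> members (prod_class \<Sigma>1 \<Sigma>2)"
  using assms pair_nat_isomorphic[of A B]
    is_structure_map_structure[OF is_structure_pair_structure[of "voc \<Sigma>1" A "voc \<Sigma>2" B]]
  by (auto simp: prod_class_def pair_nat_def is_class_structure)

lemma sat_iso_map:
  assumes h: "iso_map h S T"
  shows "(\<And>x. x \<in> free_fo \<phi> \<Longrightarrow> v x \<in> universe S \<and> w x = h (v x)) \<Longrightarrow>
    (\<And>X. X \<in> free_so \<phi> \<Longrightarrow> V X \<subseteq> universe S \<and> W X = h ` V X) \<Longrightarrow>
    sat S v V \<phi> \<longleftrightarrow> sat T w W \<phi>"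
proof (induction \<phi> arbitrary: v w V W)
  case (Equal x y)
  then show ?case
    using h by (auto simp: iso_map_def bij_betw_def inj_on_def)
next
  case (Atom r xs)
  then have "set (map v xs) \<subseteq> universe S" "map w xs = map h (map v xs)"
    by auto
  then show ?case
    using h unfolding iso_map_def by (simp del: map_map)
next
  case (Member x X)
  then have "v x \<in> universe S" "w x = h (v x)" "V X \<subseteq> universe S" "W X = h ` V X"
    by auto
  then show ?case
    using h inj_on_image_mem_iff[of h "universe S" "v x" "V X"]
    by (simp add: iso_map_def bij_betw_def)
next
  case (Neg \<phi>)
  have "sat S v V \<phi> = sat T w W \<phi>"
    by (rule Neg.IH; use Neg.prems in simp)
  then show ?case by simp
next
  case (Conj \<phi> \<psi>)
  have "sat S v V \<phi> = sat T w W \<phi>" "sat S v V \<psi> = sat T w W \<psi>"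
    by (rule Conj.IH; use Conj.prems in simp)+
  then show ?case by simp
next
  case (Ex x \<phi>)
  have "sat S (v(x := a)) V \<phi> = sat T (w(x := h a)) W \<phi>" if "a \<in> universe S" for a
    by (rule Ex.IH) (use Ex.prems that in auto)
  moreover have "universe T = h ` universe S"
    using h by (simp add: iso_map_def bij_betw_def)
  ultimately show ?case by auto
next
  case (ExSet X \<phi>)
  have *: "sat S v (V(X := A)) \<phi> = sat T w (W(X := h ` A)) \<phi>" if "A \<subseteq> universe S" for A
    by (rule ExSet.IH) (use ExSet.prems that in auto)
  have "universe T = h ` universe S"
    using h by (simp add: iso_map_def bij_betw_def)
  then have "(\<exists>B. B \<subseteq> universe T \<and> P B) \<longleftrightarrow> (\<exists>A. A \<subseteq> universe S \<and> P (h ` A))" for P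
    by (auto simp: subset_image_iff)
  with * show ?case by auto
qed simp

lemma holds_iso_map:
  assumes "iso_map h S T" "formula_with u (length xs) \<phi>" "set xs \<subseteq> universe S"
  shows "holds S xs \<phi> \<longleftrightarrow> holds T (map h xs) \<phi>"
  unfolding holds_def
  by (rule sat_iso_map[OF assms(1)]) (use assms(2,3) in \<open>auto simp: formula_with_def subset_iff\<close>)

lemma query_result_iso_map:
  assumes h: "iso_map h S T" and q: "is_query u F q" and xs: "set xs \<subseteq> universe S"
  shows "(i, xs) \<in> query_result F q S \<longleftrightarrow> (i, map h xs) \<in> query_result F q T"
proof (cases "i \<in> components F \<and> length xs = dimension F i")
  case True
  then have "holds S xs (q i) \<longleftrightarrow> holds T (map h xs) (q i)"
    using holds_iso_map[OF h, of u xs "q i"] q xs by (auto simp: is_query_def)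
  moreover have "set (map h xs) \<subseteq> universe T"
    using xs h by (auto simp: iso_map_def bij_betw_def)
  ultimately show ?thesis
    using True xs by (simp add: query_result_def functor_apply_def)
next
  case False
  then show ?thesis
    by (auto simp: query_result_def functor_apply_def)
qed

lemma interpreted_isomorphic:
  assumes ST: "S \<cong> T" and I: "is_interpretation v w I"
  shows "interpreted w I S \<cong> interpreted w I T"
proof -
  obtain h where h: "iso_map h S T"
    using ST by (auto simp: isomorphic_iff)
  let ?g = "\<lambda>(i, xs). (i, map h xs)"
  let ?q = "query_result (ifunctor I) (universe_query I)"
  have q: "is_query v (ifunctor I) (universe_query I)"
    using I by (simp add: is_interpretation_def)
  have img: "universe T = h ` universe S" and inj: "inj_on h (universe S)"
    using h by (auto simp: iso_map_def bij_betw_def)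
  have sub: "set xs \<subseteq> universe S" if "(i, xs) \<in> ?q S" for i xs
    using that by (auto simp: query_result_def functor_apply_def)
  have "inj_on ?g (?q S)"
  proof (rule inj_onI, clarsimp)
    fix i xs ys
    assume "(i, xs) \<in> ?q S" "(i, ys) \<in> ?q S" "map h xs = map h ys"
    then show "xs = ys"
      using sub[of i xs] sub[of i ys] inj
      by (meson inj_on_map_eq_map inj_on_subset le_sup_iff)
  qed
  moreover have "?g ` ?q S = ?q T"
  proof (intro set_eqI iffI)
    fix p
    assume "p \<in> ?g ` ?q S"
    then obtain i xs where ix: "(i, xs) \<in> ?q S" and p: "p = (i, map h xs)"
      by auto
    then show "p \<in> ?q T"
      using query_result_iso_map[OF h q sub[OF ix]] by blast
  next
    fix p
    assume p: "p \<in> ?q T"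
    obtain i ys where [simp]: "p = (i, ys)"
      by (cases p)
    have "set ys \<subseteq> h ` universe S"
      using p img by (auto simp: query_result_def functor_apply_def)
    then have "ys \<in> lists (h ` universe S)"
      by auto
    then obtain xs where xs: "set xs \<subseteq> universe S" "ys = map h xs"
      by (auto simp: lists_image)
    then have "(i, xs) \<in> ?q S"
      using p query_result_iso_map[OF h q xs(1)] by simp
    then show "p \<in> ?g ` ?q S"
      using xs by force
  qed
  ultimately have bij: "bij_betw ?g (?q S) (?q T)"
    by (simp add: bij_betw_def)
  have "es \<in> interp (interpreted w I S) s \<longleftrightarrow> map ?g es \<in> interp (interpreted w I T) s"
    if es: "set es \<subseteq> ?q S" for s es
  proof (cases "w s = Some (length es)")
    case True
    let ?F = "functor_power (ifunctor I) (length es)"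
    have "is_query v ?F (relation_query I s)"
      using I True by (simp add: is_interpretation_def)
    moreover have "set (snd (flatten es)) \<subseteq> universe S"
      using es sub by (fastforce simp: flatten_def)
    ultimately have "flatten es \<in> query_result ?F (relation_query I s) S \<longleftrightarrow>
        (fst (flatten es), map h (snd (flatten es))) \<in> query_result ?F (relation_query I s) T"
      using query_result_iso_map[OF h, of v ?F "relation_query I s" "snd (flatten es)"
          "fst (flatten es)"] by simp
    moreover have "flatten (map ?g es) = (fst (flatten es), map h (snd (flatten es)))"
      by (auto simp: flatten_def map_concat comp_def case_prod_beta)
    moreover have "set (map ?g es) \<subseteq> ?q T"
      unfolding set_map using image_mono[OF es, of ?g] bij by (simp only: bij_betw_def)
    ultimately show ?thesis
      using True es by (simp add: interpreted_def Let_def)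
  next
    case False
    then show ?thesis
      by (simp add: interpreted_def Let_def)
  qed
  with bij show ?thesis
    unfolding isomorphic_iff iso_map_def
    by (intro exI[of _ ?g]) (simp add: interpreted_def Let_def)
qed

lemma realizes_isomorphic:
  assumes "realizes I \<Sigma> \<Gamma> f" "S \<in> members \<Sigma>" "T \<in> members \<Sigma>" "S \<cong> T"
  shows "f S \<cong> f T"
  using assms interpreted_isomorphic[of S T "voc \<Sigma>" "voc \<Gamma>" I]
  by (meson isomorphic_sym isomorphic_trans realizes_def)

lemma pair_structure_isomorphic:
  assumes "A \<cong> A'" "B \<cong> B'"
  shows "pair_structure A B \<cong> pair_structure A' B'"
proof -
  obtain h k where h: "iso_map h A A'" and k: "iso_map k B B'"
    using assms by (auto simp: isomorphic_iff)
  let ?g = "map_sum h k"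
  have hk: "inj_on h (universe A)" "inj_on k (universe B)"
    "universe A' = h ` universe A" "universe B' = k ` universe B"
    using h k by (simp_all add: iso_map_def bij_betw_def)
  have inj: "inj_on ?g (universe A <+> universe B)"
  proof (rule inj_onI)
    fix p q
    assume "p \<in> universe A <+> universe B" "q \<in> universe A <+> universe B" "?g p = ?g q"
    then show "p = q"
      using hk(1,2) by (cases p; cases q) (auto dest: inj_onD)
  qed
  have bij: "bij_betw ?g (universe A <+> universe B) (universe A' <+> universe B')"
    using inj hk(3,4) by (simp add: bij_betw_def Plus_def image_Un image_image)
  have inl: "map ?g (map Inl ys) = map Inl (map h ys)"
    and inr: "map ?g (map Inr zs) = map Inr (map k zs)" for ys zs
    by auto
  have "xs \<in> pair_interp A B r \<longleftrightarrow> map ?g xs \<in> pair_interp A' B' r"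
    if xs: "set xs \<subseteq> universe A <+> universe B" for r xs
  proof (cases r)
    case (Fst_Name s)
    show ?thesis
    proof (cases "\<exists>ys. xs = map Inl ys")
      case True
      then obtain ys where ys: "xs = map Inl ys" by blast
      then have "set ys \<subseteq> universe A" using xs by auto
      then have "ys \<in> interp A s \<longleftrightarrow> map h ys \<in> interp A' s"
        using h by (simp add: iso_map_def)
      then show ?thesis
        by (simp only: Fst_Name pair_interp.simps ys inl inj_image_mem_iff[OF inj_mapI[OF inj_Inl]])
    next
      case False
      have "map ?g xs \<noteq> map Inl ys" for ys
      proof
        assume eq: "map ?g xs = map Inl ys"
        have "\<forall>x \<in> set xs. isl x"
        proof
          fix x assume "x \<in> set xs"
          then have "?g x \<in> set (map Inl ys)" by (metis eq image_eqI list.set_map)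
          then show "isl x" by (cases x) auto
        qed
        then have "xs = map Inl (map projl xs)"
          by (simp add: map_idI)
        with False show False by blast
      qed
      with False show ?thesis
        unfolding Fst_Name pair_interp.simps image_iff by blast
    qed
  next
    case (Snd_Name s)
    show ?thesis
    proof (cases "\<exists>ys. xs = map Inr ys")
      case True
      then obtain ys where ys: "xs = map Inr ys" by blast
      then have "set ys \<subseteq> universe B" using xs by auto
      then have "ys \<in> interp B s \<longleftrightarrow> map k ys \<in> interp B' s"
        using k by (simp add: iso_map_def)
      then show ?thesis
        by (simp only: Snd_Name pair_interp.simps ys inr inj_image_mem_iff[OF inj_mapI[OF inj_Inr]])
    next
      case False
      have "map ?g xs \<noteq> map Inr ys" for ys
      proof
        assume eq: "map ?g xs = map Inr ys"
        have "\<forall>x \<in> set xs. \<not> isl x"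
        proof
          fix x assume "x \<in> set xs"
          then have "?g x \<in> set (map Inr ys)" by (metis eq image_eqI list.set_map)
          then show "\<not> isl x" by (cases x) auto
        qed
        then have "xs = map Inr (map projr xs)"
          by (simp add: map_idI)
        with False show False by blast
      qed
      with False show ?thesis
        unfolding Snd_Name pair_interp.simps image_iff by blast
    qed
  next
    case Is_Fst
    have "h x \<in> universe A'" if "x \<in> universe A" for x
      using h that by (auto simp: iso_map_def bij_betw_def)
    then show ?thesis
      using xs by (cases xs; cases "hd xs") (auto simp: Is_Fst)
  qed
  with bij show ?thesis
    unfolding isomorphic_iff iso_map_def by (intro exI[of _ ?g]) (simp add: pair_structure_def)
qed

lemma pair_nat_cong_isomorphic:
  assumes "A \<cong> A'" "B \<cong> B'"
  shows "pair_nat A B \<cong> pair_nat A' B'"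
  using pair_structure_isomorphic[OF assms] pair_nat_isomorphic isomorphic_sym isomorphic_trans
  by meson

lemma fold_list_isomorphic:
  assumes \<Sigma>: "is_class \<Sigma>" and \<Gamma>: "is_class \<Gamma>" and \<delta>: "realizes I (prod_class \<Gamma> \<Sigma>) \<Gamma> \<delta>"
  shows "list_all2 (\<lambda>A A'. A \<in> members \<Sigma> \<and> A' \<in> members \<Sigma> \<and> A \<cong> A') As As' \<Longrightarrow>
    B \<in> members \<Gamma> \<Longrightarrow> B' \<in> members \<Gamma> \<Longrightarrow> B \<cong> B' \<Longrightarrow>
    fold_list \<delta> B As \<in> members \<Gamma> \<and> fold_list \<delta> B As \<cong> fold_list \<delta> B' As'"
proof (induction As As' arbitrary: B B' rule: list_all2_induct)
  case Nil
  then show ?case by (simp add: fold_list_def)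
next
  case (Cons A As A' As')
  have P: "pair_nat B A \<in> members (prod_class \<Gamma> \<Sigma>)" "pair_nat B' A' \<in> members (prod_class \<Gamma> \<Sigma>)"
    using Cons pair_nat_in_prod_class[OF \<Gamma> \<Sigma>] by auto
  moreover have "pair_nat B A \<cong> pair_nat B' A'"
    using Cons by (auto intro: pair_nat_cong_isomorphic)
  ultimately have "\<delta> (pair_nat B A) \<cong> \<delta> (pair_nat B' A')"
    using realizes_isomorphic[OF \<delta>] by blast
  moreover have "\<delta> (pair_nat B A) \<in> members \<Gamma>" "\<delta> (pair_nat B' A') \<in> members \<Gamma>"
    using P \<delta> by (auto simp: realizes_def)
  ultimately show ?case
    using Cons.IH by (simp add: fold_list_def)
qed

lemma strict_mono_bij_lessThan:
  fixes g :: "nat \<Rightarrow> nat"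
  assumes bij: "bij_betw g {..<n} {..<m}"
    and mono: "\<And>i j. i < n \<Longrightarrow> j < n \<Longrightarrow> i \<le> j \<longleftrightarrow> g i \<le> g j"
    and i: "i < n"
  shows "g i = i"
proof -
  have gm: "g i < m"
    using bij i by (auto simp: bij_betw_def)
  have "g ` {..<i} = {..<g i}"
  proof (intro set_eqI iffI)
    fix y assume "y \<in> g ` {..<i}"
    then obtain j where "j < i" "y = g j" by auto
    then show "y \<in> {..<g i}"
      using i mono[of i j] by (auto simp: not_le[symmetric])
  next
    fix y assume y: "y \<in> {..<g i}"
    then have "y \<in> g ` {..<n}"
      using gm bij by (auto simp: bij_betw_def)
    then obtain j where "j < n" "y = g j" by auto
    then show "y \<in> g ` {..<i}"
      using y i mono[of i j] by (auto simp: not_le[symmetric])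
  qed
  moreover have "inj_on g {..<i}"
    using bij i by (auto simp: bij_betw_def intro: inj_on_subset)
  ultimately have "card {..<i} = card {..<g i}"
    by (metis card_image)
  then show ?thesis by simp
qed

lemma list_interp_Item_Name:
  assumes "v r = Some (length xs)" "xs \<noteq> []"
  shows "map (Pair i) xs \<in> list_interp v As (Item_Name r) \<longleftrightarrow>
    i < length As \<and> xs \<in> interp (As ! i) r"
proof -
  have "j = i \<and> zs = xs" if eq: "map (Pair i) xs = map (Pair j) zs" for j zs
  proof
    show "j = i"
      using eq assms(2) by (cases xs; cases zs) auto
    show "zs = xs"
      using arg_cong[OF eq, of "map snd"] by (simp add: comp_def)
  qed
  moreover have "v r \<noteq> Some 0"
    using assms by simp
  ultimately show ?thesis
    by (simp only: list_interp.simps if_False mem_Collect_eq) blast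
qed

lemma list_structure_isomorphic:
  assumes iso: "list_structure v As \<cong> list_structure v As'"
    and As: "\<And>A. A \<in> set As \<Longrightarrow> is_structure v A \<and> universe A \<noteq> {}"
    and As': "\<And>A. A \<in> set As' \<Longrightarrow> is_structure v A \<and> universe A \<noteq> {}"
  shows "list_all2 (\<cong>) As As'"
proof -
  obtain h where h: "iso_map h (list_structure v As) (list_structure v As')"
    using iso by (auto simp: isomorphic_iff)
  have bij: "bij_betw h (list_universe As) (list_universe As')"
    using h by (simp add: iso_map_def list_structure_def)
  have hI: "xs \<in> list_interp v As r \<longleftrightarrow> map h xs \<in> list_interp v As' r"
    if "set xs \<subseteq> list_universe As" for xs r
    using h that by (simp add: iso_map_def list_structure_def)
  have ord: "fst p \<le> fst q \<longleftrightarrow> fst (h p) \<le> fst (h q)"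
    if "p \<in> list_universe As" "q \<in> list_universe As" for p q
  proof -
    have "h p \<in> list_universe As'" "h q \<in> list_universe As'"
      using that bij by (auto simp: bij_betw_def)
    moreover have "[p, q] \<in> list_interp v As Precedes \<longleftrightarrow>
        [h p, h q] \<in> list_interp v As' Precedes"
      using hI[of "[p, q]" Precedes] that by simp
    ultimately show ?thesis
      using that by (cases p; cases q; cases "h p"; cases "h q") auto
  qed
  have ne: "\<exists>x. (i, x) \<in> list_universe As" if "i < length As" for i
    using As[of "As ! i"] that by (auto simp: list_universe_def)
  have ne': "\<exists>x. (i, x) \<in> list_universe As'" if "i < length As'" for i
    using As'[of "As' ! i"] that by (auto simp: list_universe_def)
  define g where "g i = fst (h (i, SOME x. (i, x) \<in> list_universe As))" for i
  have some: "(i, SOME x. (i, x) \<in> list_universe As) \<in> list_universe As" if "i < length As" for i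
    using ne[OF that] by (rule someI_ex)
  have lt: "i < length As" if "(i, x) \<in> list_universe As" for i x
    using that by (simp add: list_universe_def)
  have lt': "i < length As'" if "(i, x) \<in> list_universe As'" for i x
    using that by (simp add: list_universe_def)
  have g: "fst (h (i, x)) = g i" if "(i, x) \<in> list_universe As" for i x
    using ord[OF that some[OF lt[OF that]]] ord[OF some[OF lt[OF that]] that]
    by (simp add: g_def)
  have mono: "i \<le> j \<longleftrightarrow> g i \<le> g j" if "i < length As" "j < length As" for i j
    using ord[OF some[OF that(1)] some[OF that(2)]] by (simp add: g_def)
  have gbij: "bij_betw g {..<length As} {..<length As'}"
    unfolding bij_betw_def
  proof (intro conjI set_eqI iffI inj_onI)
    fix i j assume "i \<in> {..<length As}" "j \<in> {..<length As}" "g i = g j"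
    then show "i = j"
      using mono[of i j] mono[of j i] by simp
  next
    fix j assume "j \<in> g ` {..<length As}"
    then obtain i where i: "i < length As" "j = g i" by auto
    have "h (i, SOME x. (i, x) \<in> list_universe As) \<in> list_universe As'"
      using some[OF i(1)] bij by (auto simp: bij_betw_def)
    then have "g i < length As'"
      using lt' unfolding g_def by (metis prod.collapse)
    then show "j \<in> {..<length As'}" by (simp add: i)
  next
    fix j assume "j \<in> {..<length As'}"
    then obtain y where "(j, y) \<in> list_universe As'"
      using ne' by blast
    then obtain i x where ix: "(i, x) \<in> list_universe As" "h (i, x) = (j, y)"
      using bij by (metis (no_types, lifting) bij_betw_def imageE prod.collapse)
    then have "j = g i" using g[OF ix(1)] by simp
    then show "j \<in> g ` {..<length As}" using lt[OF ix(1)] by auto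
  qed
  then have len: "length As = length As'"
    using bij_betw_same_card by fastforce
  have fst_h: "fst (h (i, x)) = i" if "(i, x) \<in> list_universe As" for i x
    using g[OF that] strict_mono_bij_lessThan[OF gbij mono lt[OF that]] by simp
  have "As ! i \<cong> As' ! i" if i: "i < length As" for i
  proof -
    let ?k = "\<lambda>x. snd (h (i, x))"
    have hk: "h (i, x) = (i, ?k x)" "?k x \<in> universe (As' ! i)"
      if "x \<in> universe (As ! i)" for x
    proof -
      have u: "(i, x) \<in> list_universe As"
        using that i by (simp add: list_universe_def)
      then show *: "h (i, x) = (i, ?k x)"
        using fst_h by (metis prod.collapse)
      have "h (i, x) \<in> list_universe As'"
        using u bij by (auto simp: bij_betw_def)
      then show "?k x \<in> universe (As' ! i)"
        using * by (simp add: list_universe_def split: prod.splits)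
    qed
    have "bij_betw ?k (universe (As ! i)) (universe (As' ! i))"
      unfolding bij_betw_def
    proof (intro conjI set_eqI iffI inj_onI)
      fix x y assume xy: "x \<in> universe (As ! i)" "y \<in> universe (As ! i)" "?k x = ?k y"
      then have "h (i, x) = h (i, y)"
        using hk(1) by metis
      moreover have "(i, x) \<in> list_universe As" "(i, y) \<in> list_universe As"
        using xy i by (auto simp: list_universe_def)
      ultimately show "x = y"
        using bij by (auto simp: bij_betw_def inj_on_def)
    next
      fix y assume "y \<in> ?k ` universe (As ! i)"
      then show "y \<in> universe (As' ! i)" using hk(2) by auto
    next
      fix y assume "y \<in> universe (As' ! i)"
      then have "(i, y) \<in> list_universe As'"
        using i len by (simp add: list_universe_def)
      then obtain j x where jx: "(j, x) \<in> list_universe As" "h (j, x) = (i, y)"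
        using bij by (metis (no_types, lifting) bij_betw_def imageE prod.collapse)
      then have "j = i" using fst_h by fastforce
      with jx show "y \<in> ?k ` universe (As ! i)"
        by (force simp: list_universe_def)
    qed
    moreover have "xs \<in> interp (As ! i) r \<longleftrightarrow> map ?k xs \<in> interp (As' ! i) r"
      if xs: "set xs \<subseteq> universe (As ! i)" for r xs
    proof (cases "v r = Some (length xs)")
      case False
      have "is_structure v (As ! i)" "is_structure v (As' ! i)"
        using As As' i len by auto
      with False show ?thesis
        by (force simp: is_structure_def)
    next
      case ar: True
      show ?thesis
      proof (cases xs)
        case Nil
        obtain x where x: "(i, x) \<in> list_universe As"
          using ne[OF i] by blast
        then have xu: "x \<in> universe (As ! i)" by (simp add: list_universe_def)
        have hu: "(i, ?k x) \<in> list_universe As'"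
          using hk(2)[OF xu] i len by (simp add: list_universe_def)
        have "[(i, x)] \<in> list_interp v As (Item_Name r) \<longleftrightarrow>
            [h (i, x)] \<in> list_interp v As' (Item_Name r)"
          using hI[of "[(i, x)]" "Item_Name r"] x by simp
        then have "[(i, x)] \<in> list_interp v As (Item_Name r) \<longleftrightarrow>
            [(i, ?k x)] \<in> list_interp v As' (Item_Name r)"
          by (simp only: hk(1)[OF xu, symmetric])
        then show ?thesis
          using x hu ar Nil by simp
      next
        case (Cons x0 xs0)
        have "map h (map (Pair i) xs) = map (Pair i) (map ?k xs)"
          unfolding map_map comp_def using xs hk(1) by (intro map_cong refl) blast
        moreover have "set (map (Pair i) xs) \<subseteq> list_universe As"
          using xs i by (auto simp: list_universe_def)
        ultimately have "map (Pair i) xs \<in> list_interp v As (Item_Name r) \<longleftrightarrow>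
            map (Pair i) (map ?k xs) \<in> list_interp v As' (Item_Name r)"
          using hI by metis
        then show ?thesis
          using i len ar Cons list_interp_Item_Name[of v r xs i As]
            list_interp_Item_Name[of v r "map ?k xs" i As'] by simp
      qed
    qed
    ultimately show ?thesis
      unfolding isomorphic_iff iso_map_def by blast
  qed
  with len show ?thesis
    by (simp add: list_all2_conv_all_nth)
qed

theorem fold_function_list:
  assumes \<Sigma>: "is_class \<Sigma>" and \<Gamma>: "is_class \<Gamma>" and B0: "B0 \<in> members \<Gamma>"
    and \<delta>: "quantifier_free_interpretation (prod_class \<Gamma> \<Sigma>) \<Gamma> \<delta>"
    and As: "item_list \<Sigma> As" and S: "list_structure (voc \<Sigma>) As \<cong> S"
  shows "fold_function \<Sigma> \<delta> B0 S \<cong> fold_list \<delta> B0 As"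
proof -
  obtain I where I: "realizes I (prod_class \<Gamma> \<Sigma>) \<Gamma> \<delta>"
    using \<delta> by (auto simp: quantifier_free_interpretation_def)
  define As' where "As' = (SOME As. item_list \<Sigma> As \<and> list_structure (voc \<Sigma>) As \<cong> S)"
  have "item_list \<Sigma> As' \<and> list_structure (voc \<Sigma>) As' \<cong> S"
    unfolding As'_def
    by (rule someI[where P = "\<lambda>As. item_list \<Sigma> As \<and> list_structure (voc \<Sigma>) As \<cong> S"])
      (rule conjI[OF As S])
  then have As': "item_list \<Sigma> As'" and "list_structure (voc \<Sigma>) As' \<cong> list_structure (voc \<Sigma>) As"
    using isomorphic_trans[OF _ isomorphic_sym[OF S]] by blast+
  then have "list_all2 (\<cong>) As' As"
    using \<Sigma> As by (intro list_structure_isomorphic) (auto simp: item_list_def is_class_structure)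
  then have "list_all2 (\<lambda>A A'. A \<in> members \<Sigma> \<and> A' \<in> members \<Sigma> \<and> A \<cong> A') As' As"
    using As As' by (auto simp: list_all2_conv_all_nth item_list_def)
  then show ?thesis
    using fold_list_isomorphic[OF \<Sigma> \<Gamma> I _ B0 B0 isomorphic_refl]
    unfolding fold_function_def As'_def by blast
qed

end

theory Submission
  imports Defs "HOL-Library.Countable_Set"
begin

text \<open>
  Since \<open>\<delta>\<close> is quantifier-free over the identity functor, every element of the fold is either one
  of the finitely many elements of \<open>B0\<close>, encoded by a component of dimension \<open>0\<close>, or an element of
  the input, encoded by the component of dimension \<open>1\<close>. Fix a tuple of such elements. Which entries
  are alive, and which relations hold between them, after an item has been read are finitely many
  facts, and by quantifier-freeness their truth values after item \<open>i\<close> depend only on their truth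
  values before it and on the atomic relations between the entries lying in item \<open>i\<close>. They thus form
  the run of a finite automaton, which an MSO formula guesses with one set variable per fact: the set
  of those input elements after whose item the fact is true.
\<close>


section \<open>Derived formulas\<close>

abbreviation "Disj \<phi> \<psi> \<equiv> Neg (Conj (Neg \<phi>) (Neg \<psi>))"

abbreviation "Iff \<phi> \<psi> \<equiv> Conj (Neg (Conj \<phi> (Neg \<psi>))) (Neg (Conj \<psi> (Neg \<phi>)))"

abbreviation "Forall x \<phi> \<equiv> Neg (Ex x (Neg \<phi>))"

definition truth :: "bool \<Rightarrow> 'r mso" where
  "truth b = (if b then Neg Falsum else Falsum)"

lemma truth_simps [simp]:
  "sat S v V (truth b) \<longleftrightarrow> b"
  "free_fo (truth b) = {}"
  "free_so (truth b) = {}"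
  "over_voc u (truth b)"
  by (simp_all add: truth_def)

primrec Conjs :: "'r mso list \<Rightarrow> 'r mso" where
  "Conjs [] = Neg Falsum"
| "Conjs (\<phi> # \<phi>s) = Conj \<phi> (Conjs \<phi>s)"

lemma Conjs_simps [simp]:
  "sat S v V (Conjs \<phi>s) \<longleftrightarrow> (\<forall>\<phi> \<in> set \<phi>s. sat S v V \<phi>)"
  "free_fo (Conjs \<phi>s) = (\<Union>\<phi> \<in> set \<phi>s. free_fo \<phi>)"
  "free_so (Conjs \<phi>s) = (\<Union>\<phi> \<in> set \<phi>s. free_so \<phi>)"
  "over_voc u (Conjs \<phi>s) \<longleftrightarrow> (\<forall>\<phi> \<in> set \<phi>s. over_voc u \<phi>)"
  by (induction \<phi>s) simp_all

abbreviation ExSets :: "nat list \<Rightarrow> 'r mso \<Rightarrow> 'r mso" where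
  "ExSets Xs \<phi> \<equiv> foldr ExSet Xs \<phi>"

lemma ExSets_simps [simp]:
  "free_fo (ExSets Xs \<phi>) = free_fo \<phi>"
  "free_so (ExSets Xs \<phi>) = free_so \<phi> - set Xs"
  "over_voc u (ExSets Xs \<phi>) \<longleftrightarrow> over_voc u \<phi>"
  by (induction Xs) auto

text \<open>A single function \<open>W\<close> chooses all sets of a quantifier block at once, so
  the guess of a whole run can be handled as one object.\<close>

lemma sat_ExSets:
  "sat S v V (ExSets Xs \<phi>) \<longleftrightarrow>
    (\<exists>W. (\<forall>X. W X \<subseteq> universe S) \<and> sat S v (\<lambda>X. if X \<in> set Xs then W X else V X) \<phi>)"
proof (induction Xs arbitrary: V)
  case Nil
  then show ?case by (auto intro!: exI[of _ "\<lambda>_. {}"])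
next
  case (Cons Y Xs)
  have "(\<exists>A\<subseteq>universe S. \<exists>W. (\<forall>X. W X \<subseteq> universe S) \<and>
      P (\<lambda>X. if X \<in> set Xs then W X else (V(Y := A)) X)) \<longleftrightarrow>
    (\<exists>W. (\<forall>X. W X \<subseteq> universe S) \<and> P (\<lambda>X. if X \<in> set (Y # Xs) then W X else V X))"
    (is "?L \<longleftrightarrow> ?R") for P
  proof
    assume ?L
    then obtain A W where "A \<subseteq> universe S" "\<forall>X. W X \<subseteq> universe S"
      and P: "P (\<lambda>X. if X \<in> set Xs then W X else (V(Y := A)) X)"
      by blast
    \<comment> \<open>If \<open>Y\<close> occurs again in \<open>Xs\<close>, the inner quantifier
      overrides the outer one; hence \<open>W\<close> takes precedence over
      \<open>A\<close>.\<close>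
    moreover from P have "P (\<lambda>X. if X \<in> set (Y # Xs)
        then (if X \<in> set Xs then W X else A) else V X)"
      by (rule back_subst[where P = P]) (auto simp: fun_eq_iff)
    ultimately show ?R
      by (intro exI[of _ "\<lambda>X. if X \<in> set Xs then W X else A"]) auto
  next
    assume ?R
    then obtain W where W: "\<forall>X. W X \<subseteq> universe S"
      and P: "P (\<lambda>X. if X \<in> set (Y # Xs) then W X else V X)"
      by blast
    from P have "P (\<lambda>X. if X \<in> set Xs then W X else (V(Y := W Y)) X)"
      by (rule back_subst[where P = P]) (auto simp: fun_eq_iff)
    with W show ?L by blast
  qed
  with Cons show ?case by simp
qed


declare isomorphic_trans [trans]


section \<open>The order of the list items\<close>

definition "before x y = Conj (Atom Precedes [x, y]) (Neg (Atom Precedes [y, x]))"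

definition "same_item x y = Conj (Atom Precedes [x, y]) (Atom Precedes [y, x])"

text \<open>Variables are concrete numbers, so the bound variable \<open>z\<close> is passed as an
  argument; the formulas mean what they should once it differs from the free variables.\<close>

definition "first_item y z = Neg (Ex z (before z y))"

definition "last_item y z = Neg (Ex z (before y z))"

definition "next_item x y z = Conj (before x y) (Neg (Ex z (Conj (before x z) (before z y))))"

lemmas item_formula_defs =
  before_def same_item_def first_item_def last_item_def next_item_def

lemma list_structure_simps [simp]:
  "universe (list_structure v As) = list_universe As"
  "interp (list_structure v As) = list_interp v As"
  by (simp_all add: list_structure_def)

context
  fixes u :: "'r vocabulary" and As :: "('r, nat) rel_structure list"
  assumes nonempty: "\<And>A. A \<in> set As \<Longrightarrow> universe A \<noteq> {}"
begin

text \<open>Formulas quantify over elements, not over items. Nonemptiness makes every index visible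
  through some element, which is what lets the first, the last and the next item be defined.\<close>

lemma item_witness: "i < length As \<Longrightarrow> \<exists>x. (i, x) \<in> list_universe As"
  using nonempty[of "As ! i"] by (auto simp: list_universe_def)

lemma index_less: "p \<in> list_universe As \<Longrightarrow> fst p < length As"
  by (auto simp: list_universe_def)

lemma sat_Precedes:
  "val x \<in> list_universe As \<Longrightarrow> val y \<in> list_universe As \<Longrightarrow>
    [val x, val y] \<in> list_interp u As Precedes \<longleftrightarrow> fst (val x) \<le> fst (val y)"
  by (cases "val x"; cases "val y") simp

lemma sat_before:
  "val x \<in> list_universe As \<Longrightarrow> val y \<in> list_universe As \<Longrightarrow>
    sat (list_structure u As) val V (before x y) \<longleftrightarrow> fst (val x) < fst (val y)"
  by (auto simp: before_def sat_Precedes simp del: list_interp.simps)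

lemma sat_same_item:
  "val x \<in> list_universe As \<Longrightarrow> val y \<in> list_universe As \<Longrightarrow>
    sat (list_structure u As) val V (same_item x y) \<longleftrightarrow> fst (val x) = fst (val y)"
  by (auto simp: same_item_def sat_Precedes simp del: list_interp.simps)

lemma sat_first_item:
  assumes y: "val y \<in> list_universe As" and "z \<noteq> y"
  shows "sat (list_structure u As) val V (first_item y z) \<longleftrightarrow> fst (val y) = 0"
proof -
  have "sat (list_structure u As) val V (first_item y z) \<longleftrightarrow>
      \<not> (\<exists>p \<in> list_universe As. fst p < fst (val y))"
    using assms by (auto simp: first_item_def sat_before)
  also have "\<dots> \<longleftrightarrow> fst (val y) = 0"
    using item_witness[of 0] index_less[OF y] by fastforce
  finally show ?thesis .
qed

lemma sat_last_item:
  assumes y: "val y \<in> list_universe As" and "z \<noteq> y"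
  shows "sat (list_structure u As) val V (last_item y z) \<longleftrightarrow> Suc (fst (val y)) = length As"
proof -
  have "sat (list_structure u As) val V (last_item y z) \<longleftrightarrow>
      \<not> (\<exists>p \<in> list_universe As. fst (val y) < fst p)"
    using assms by (auto simp: last_item_def sat_before)
  also have "\<dots> \<longleftrightarrow> Suc (fst (val y)) = length As"
  proof
    assume no: "\<not> (\<exists>p \<in> list_universe As. fst (val y) < fst p)"
    have "\<not> Suc (fst (val y)) < length As"
      using item_witness[of "Suc (fst (val y))"] no by fastforce
    with index_less[OF y] show "Suc (fst (val y)) = length As" by simp
  next
    assume "Suc (fst (val y)) = length As"
    then show "\<not> (\<exists>p \<in> list_universe As. fst (val y) < fst p)"
      using index_less by fastforce
  qed
  finally show ?thesis .
qed

lemma sat_next_item: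
  assumes "val x \<in> list_universe As" and y: "val y \<in> list_universe As" and "z \<noteq> x" "z \<noteq> y"
  shows "sat (list_structure u As) val V (next_item x y z) \<longleftrightarrow> fst (val y) = Suc (fst (val x))"
proof -
  have "sat (list_structure u As) val V (next_item x y z) \<longleftrightarrow> fst (val x) < fst (val y) \<and>
      \<not> (\<exists>p \<in> list_universe As. fst (val x) < fst p \<and> fst p < fst (val y))"
    using assms by (auto simp: next_item_def sat_before)
  also have "\<dots> \<longleftrightarrow> fst (val y) = Suc (fst (val x))"
  proof
    assume no: "fst (val x) < fst (val y) \<and>
      \<not> (\<exists>p \<in> list_universe As. fst (val x) < fst p \<and> fst p < fst (val y))"
    then have "Suc (fst (val x)) < length As"
      using index_less[OF y] by simp
    \<comment> \<open>Otherwise an element of the item with index \<open>Suc (fst (val x))\<close>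
      would lie strictly in between.\<close>
    then have "\<not> Suc (fst (val x)) < fst (val y)"
      using item_witness[of "Suc (fst (val x))"] no by fastforce
    with no show "fst (val y) = Suc (fst (val x))" by simp
  qed auto
  finally show ?thesis .
qed

end


section \<open>The fold on the disjoint union of the initial state and the items\<close>

text \<open>Plays the role of \<open>pair_structure\<close> with the type of elements fixed: old
  elements keep their names, and an element of the item is named by its index and itself, as in
  \<open>list_universe\<close>.\<close>

definition joint :: "nat \<Rightarrow> ('r, nat) rel_structure \<Rightarrow> ('s, nat + nat \<times> nat) rel_structure \<Rightarrow>
    (('s, 'r) prod_name, nat + nat \<times> nat) rel_structure" where
  "joint i A C =
     \<lparr>universe = universe C \<union> (\<lambda>x. Inr (i, x)) ` universe A,
      interp = (\<lambda>r. case r of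
          Fst_Name s \<Rightarrow> interp C s
        | Snd_Name s \<Rightarrow> map (\<lambda>x. Inr (i, x)) ` interp A s
        | Is_Fst \<Rightarrow> {[c] | c. c \<in> universe C})\<rparr>"

lemma iso_mapI_image:
  assumes inj: "inj_on h (universe S)" and univ: "universe T = h ` universe S"
    and sub: "\<And>r xs. xs \<in> interp S r \<Longrightarrow> set xs \<subseteq> universe S"
    and interp: "\<And>r. interp T r = map h ` interp S r"
  shows "iso_map h S T"
  unfolding iso_map_def
proof (intro conjI allI impI)
  show "bij_betw h (universe S) (universe T)"
    using inj univ by (simp add: bij_betw_def)
  show "xs \<in> interp S r \<longleftrightarrow> map h xs \<in> interp T r" if "set xs \<subseteq> universe S" for r xs
  proof
    assume "map h xs \<in> interp T r"
    then obtain ys where ys: "ys \<in> interp S r" "map h xs = map h ys"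
      using interp by auto
    then have "xs = ys"
      using inj_on_map_eq_map[of h xs ys] inj_on_subset[OF inj, of "set xs \<union> set ys"] that sub
      by auto
    with ys show "xs \<in> interp S r" by simp
  qed (simp add: interp)
qed

text \<open>The union in \<open>joint\<close> is disjoint because the index \<open>i\<close> does
  not occur in \<open>C\<close> yet.\<close>

lemma joint_isomorphic:
  assumes A: "is_structure v A" and C: "is_structure w C"
    and fresh: "\<And>x. Inr (i, x) \<notin> universe C"
  shows "pair_structure C A \<cong> joint i A C"
  unfolding isomorphic_iff
proof (intro exI iso_mapI_image)
  let ?h = "case_sum id (\<lambda>x. Inr (i, x))"
  show "inj_on ?h (universe (pair_structure C A))"
    using fresh by (auto simp: inj_on_def pair_structure_def split: sum.splits)
  show "universe (joint i A C) = ?h ` universe (pair_structure C A)"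
    by (force simp: joint_def pair_structure_def)
  show "set xs \<subseteq> universe (pair_structure C A)" if "xs \<in> interp (pair_structure C A) r" for xs r
    using is_structure_pair_structure[OF C A] that unfolding is_structure_def by blast
  show "interp (joint i A C) r = map ?h ` interp (pair_structure C A) r" for r
    by (cases r) (auto simp: joint_def pair_structure_def image_image comp_def setcompr_eq_image)
qed

text \<open>
  The slot \<open>Inl b\<close> stands for the element \<open>b\<close> of the initial state, the slot \<open>Inr j\<close> for the value of
  the first-order variable \<open>j\<close>.
\<close>

type_synonym slot = "nat + nat"

text \<open>Facts speak of slots rather than of elements, so their number does not grow with the
  input. \<open>Alive\<close> is tracked as well because the universe formula may delete
  elements.\<close>

datatype 's fact = Alive slot | Rel 's "slot list"

primrec fact_holds :: "('s, nat + 'p) rel_structure \<Rightarrow> (nat \<Rightarrow> 'p) \<Rightarrow> 's fact \<Rightarrow> bool" where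
  "fact_holds C val (Alive t) \<longleftrightarrow> map_sum id val t \<in> universe C"
| "fact_holds C val (Rel s ts) \<longleftrightarrow> map (map_sum id val) ts \<in> interp C s"

text \<open>\<open>id_functor\<close> has the single component \<open>0\<close>, so
  \<open>replicate m 0\<close> is the only component of its \<open>m\<close>-th power.\<close>

locale quantifier_free_fold =
  fixes v :: "'r vocabulary" and w :: "'s vocabulary" and B0 :: "('s, nat) rel_structure"
    and I :: "(('s, 'r) prod_name, 's) mso_interp"
  assumes finite_voc: "finite (dom w)"
    and initial: "is_structure w B0"
    and valid: "is_interpretation (prod_voc w v) w I"
    and identity: "ifunctor I = id_functor"
    and qf_universe: "quantifier_free (universe_query I 0)"
    and qf_relation: "w s = Some m \<Longrightarrow> quantifier_free (relation_query I s (replicate m 0))"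
begin

lemma formula_universe: "formula_with (prod_voc w v) 1 (universe_query I 0)"
  using valid identity by (simp add: is_interpretation_def is_query_def id_functor_def)

lemma formula_relation:
  assumes "w s = Some m"
  shows "formula_with (prod_voc w v) m (relation_query I s (replicate m 0))"
proof -
  have "is_query (prod_voc w v) (functor_power id_functor m) (relation_query I s)"
    using valid identity assms by (metis is_interpretation_def)
  moreover have "replicate m 0 \<in> components (functor_power id_functor m)"
    by (auto simp: functor_power_def id_functor_def)
  moreover have "dimension (functor_power id_functor m) (replicate m 0) = m"
    by (simp add: functor_power_def id_functor_def sum_list_replicate)
  ultimately show ?thesis
    unfolding is_query_def by metis
qed

section \<open>One step of the fold with elements keeping their names\<close>

definition survivors :: "(('s, 'r) prod_name, 'a) rel_structure \<Rightarrow> 'a set" where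
  "survivors J = {c \<in> universe J. holds J [c] (universe_query I 0)}"

text \<open>This is \<open>interpreted w I\<close> with \<open>c\<close> written for
  \<open>(0, [c])\<close>. Iterating \<open>interpreted\<close> itself would change the type of
  elements at every step.\<close>

definition successor :: "(('s, 'r) prod_name, 'a) rel_structure \<Rightarrow> ('s, 'a) rel_structure" where
  "successor J =
     \<lparr>universe = survivors J,
      interp = (\<lambda>s. {cs. w s = Some (length cs) \<and> set cs \<subseteq> survivors J \<and>
         holds J cs (relation_query I s (replicate (length cs) 0))})\<rparr>"

lemma successor_isomorphic: "successor J \<cong> interpreted w I J"
proof -
  let ?h = "\<lambda>c. (0 :: nat, [c])"
  let ?U = "query_result (ifunctor I) (universe_query I) J"
  have U: "?U = ?h ` survivors J"
    by (auto simp: query_result_def functor_apply_def identity id_functor_def survivors_def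
        length_Suc_conv)
  have flat: "flatten (map ?h cs) = (replicate (length cs) 0, cs)" for cs :: "'b list"
    by (simp add: flatten_def comp_def map_replicate_const)
  have rel: "map ?h cs \<in> interp (interpreted w I J) s \<longleftrightarrow> cs \<in> interp (successor J) s"
    if "set cs \<subseteq> survivors J" for s cs
  proof -
    have "set cs \<subseteq> universe J"
      using that by (auto simp: survivors_def)
    then have "flatten (map ?h cs) \<in>
        query_result (functor_power (ifunctor I) (length cs)) (relation_query I s) J \<longleftrightarrow>
        holds J cs (relation_query I s (replicate (length cs) 0))"
      unfolding flat
      by (auto simp: query_result_def functor_apply_def functor_power_def identity id_functor_def
          sum_list_replicate)
    then show ?thesis
      using that by (auto simp: interpreted_def Let_def successor_def U)
  qed
  show ?thesis
    unfolding isomorphic_iff iso_map_def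
  proof (intro exI[of _ ?h] conjI allI impI)
    show "bij_betw ?h (universe (successor J)) (universe (interpreted w I J))"
      by (auto simp: bij_betw_def inj_on_def successor_def interpreted_def Let_def U)
    show "xs \<in> interp (successor J) s \<longleftrightarrow> map ?h xs \<in> interp (interpreted w I J) s"
      if "set xs \<subseteq> universe (successor J)" for s xs
      using rel[of xs s] that by (simp add: successor_def)
  qed
qed

lemma is_structure_successor: "finite (universe J) \<Longrightarrow> is_structure w (successor J)"
  by (auto simp: is_structure_def successor_def survivors_def)

primrec state :: "('r, nat) rel_structure list \<Rightarrow> nat \<Rightarrow> ('s, nat + nat \<times> nat) rel_structure" where
  "state As 0 = map_structure Inl B0"
| "state As (Suc i) = successor (joint i (As ! i) (state As i))"

text \<open>Gives the freshness needed to add item \<open>i\<close>, and bounds the final state by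
  the elements that the output functor has to encode.\<close>

lemma state_universe:
  "universe (state As i) \<subseteq>
    Inl ` universe B0 \<union> {Inr (j, x) | j x. j < i \<and> x \<in> universe (As ! j)}"
proof (induction i)
  case 0
  then show ?case by (auto simp: map_structure_def)
next
  case (Suc i)
  have "universe (state As (Suc i)) \<subseteq> universe (state As i) \<union> (\<lambda>x. Inr (i, x)) ` universe (As ! i)"
    by (auto simp: successor_def survivors_def joint_def)
  with Suc show ?case by (auto simp: less_Suc_eq dest!: subsetD)
qed

lemma is_structure_state:
  assumes "\<And>A. A \<in> set As \<Longrightarrow> finite (universe A)" "i \<le> length As"
  shows "is_structure w (state As i)"
  using assms(2)
proof (induction i)
  case 0
  then show ?case by (simp add: initial is_structure_map_structure)
next
  case (Suc i)
  then have "finite (universe (joint i (As ! i) (state As i)))"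
    using assms(1)[of "As ! i"] by (simp add: joint_def is_structure_def)
  then show ?case by (simp add: is_structure_successor)
qed

text \<open>Induction along the list. Membership in \<open>\<Gamma>\<close> is carried along since
  \<open>realizes\<close> describes \<open>\<delta>\<close> only on members of the product
  class.\<close>

lemma fold_list_state:
  assumes \<Sigma>: "is_class \<Sigma>" "voc \<Sigma> = v" and \<Gamma>: "is_class \<Gamma>" "voc \<Gamma> = w"
    and \<delta>: "realizes I (prod_class \<Gamma> \<Sigma>) \<Gamma> \<delta>" and B0: "B0 \<in> members \<Gamma>"
    and As: "item_list \<Sigma> As" and i: "i \<le> length As"
  shows "fold_list \<delta> B0 (take i As) \<in> members \<Gamma> \<and> fold_list \<delta> B0 (take i As) \<cong> state As i"
  using i
proof (induction i)
  case 0
  then show ?case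
    using B0 by (simp add: fold_list_def map_structure_isomorphic)
next
  case (Suc i)
  let ?B = "fold_list \<delta> B0 (take i As)"
  let ?J = "joint i (As ! i) (state As i)"
  have A: "As ! i \<in> members \<Sigma>"
    using As Suc.prems by (simp add: item_list_def)
  have B: "?B \<in> members \<Gamma>" "?B \<cong> state As i"
    using Suc by simp_all
  have P: "pair_nat ?B (As ! i) \<in> members (prod_class \<Gamma> \<Sigma>)"
    using pair_nat_in_prod_class[OF \<Gamma>(1) \<Sigma>(1) B(1) A] .
  have "\<And>A. A \<in> set As \<Longrightarrow> finite (universe A)"
    using As is_class_structure[OF \<Sigma>(1)] by (simp add: item_list_def is_structure_def)
  then have "is_structure w (state As i)"
    using Suc.prems by (simp add: is_structure_state)
  moreover have "Inr (i, x) \<notin> universe (state As i)" for x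
    using state_universe[of As i] by auto
  moreover have "is_structure v (As ! i)"
    using is_class_structure[OF \<Sigma>(1) A] \<Sigma>(2) by simp
  ultimately have "pair_structure (state As i) (As ! i) \<cong> ?J"
    by (intro joint_isomorphic)
  moreover have "pair_nat ?B (As ! i) \<cong> pair_structure (state As i) (As ! i)"
    by (rule isomorphic_trans[OF isomorphic_sym[OF pair_nat_isomorphic]
          pair_structure_isomorphic[OF B(2) isomorphic_refl]])
  ultimately have "pair_nat ?B (As ! i) \<cong> ?J"
    by (rule isomorphic_trans[rotated])
  \<comment> \<open>Interpretations respect isomorphism, so one step can be computed on
    \<open>joint\<close> instead of the coded pair.\<close>
  then have "interpreted w I (pair_nat ?B (As ! i)) \<cong> interpreted w I ?J"
    using valid by (rule interpreted_isomorphic)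
  moreover have "\<delta> (pair_nat ?B (As ! i)) \<in> members \<Gamma>"
    "\<delta> (pair_nat ?B (As ! i)) \<cong> interpreted w I (pair_nat ?B (As ! i))"
    using \<delta> P \<Gamma>(2) by (auto simp: realizes_def)
  ultimately have "\<delta> (pair_nat ?B (As ! i)) \<cong> successor ?J"
    using isomorphic_trans isomorphic_sym[OF successor_isomorphic] by meson
  moreover have "fold_list \<delta> B0 (take (Suc i) As) = \<delta> (pair_nat ?B (As ! i))"
    using Suc.prems by (simp add: fold_list_def take_Suc_conv_app_nth)
  ultimately show ?case
    using \<open>\<delta> (pair_nat ?B (As ! i)) \<in> members \<Gamma>\<close> by simp
qed

end


section \<open>The formula defining a fact\<close>

context quantifier_free_fold
begin

section \<open>Finitely many facts and their set variables\<close>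

definition slots :: "nat \<Rightarrow> slot set" where
  "slots k = Inl ` universe B0 \<union> Inr ` {..<k}"

definition facts :: "nat \<Rightarrow> 's fact set" where
  "facts k = Alive ` slots k \<union> {Rel s ts | s ts. w s = Some (length ts) \<and> set ts \<subseteq> slots k}"

text \<open>Set variables are numbers; an enumeration of the facts gives each its own.\<close>

definition fact_var :: "nat \<Rightarrow> 's fact \<Rightarrow> nat" where
  "fact_var k = to_nat_on (facts k)"

lemma facts_simps [simp]:
  "Alive t \<in> facts k \<longleftrightarrow> t \<in> slots k"
  "Rel s ts \<in> facts k \<longleftrightarrow> w s = Some (length ts) \<and> set ts \<subseteq> slots k"
  by (auto simp: facts_def)

lemma slots_simps [simp]: "Inl b \<in> slots k \<longleftrightarrow> b \<in> universe B0" "Inr j \<in> slots k \<longleftrightarrow> j < k"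
  by (auto simp: slots_def)

text \<open>There are finitely many slots as \<open>B0\<close> is finite, and finitely many relation
  names, each with a fixed arity. This makes the automaton finite.\<close>

lemma finite_facts: "finite (facts k)"
proof -
  have fin: "finite (slots k)"
    using initial by (simp add: slots_def is_structure_def)
  have "facts k \<subseteq> Alive ` slots k \<union>
      (\<Union>s \<in> dom w. Rel s ` {ts. set ts \<subseteq> slots k \<and> length ts = the (w s)})"
    by (auto simp: facts_def)
  then show ?thesis
    by (rule finite_subset) (simp add: fin finite_voc finite_lists_length_eq)
qed

lemma inj_fact_var: "inj_on (fact_var k) (facts k)"
  unfolding fact_var_def by (rule inj_on_to_nat_on[OF countable_finite[OF finite_facts]])

definition initially :: "'s fact \<Rightarrow> bool" where
  "initially f \<longleftrightarrow> fact_holds (map_structure Inl B0) (id :: nat \<Rightarrow> nat) f"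

text \<open>The initial state has only elements \<open>Inl b\<close>, while \<open>Inr j\<close>
  denotes an \<open>Inr\<close>. A fact mentioning a variable is thus false at the start, and
  initial truth is a constant that can be written into a formula; \<open>id\<close> in
  \<open>initially\<close> is a default valuation.\<close>

lemma initially_iff: "fact_holds (map_structure Inl B0) val f \<longleftrightarrow> initially f"
proof -
  have Inl: "map_sum id val' t = Inl b \<longleftrightarrow> t = Inl b" for t :: slot and b and val' :: "nat \<Rightarrow> 'p"
    by (cases t) auto
  have "map (map_sum id val') ts = map Inl bs \<longleftrightarrow> ts = map Inl bs"
    for ts :: "slot list" and bs and val' :: "nat \<Rightarrow> 'p"
    by (induction ts arbitrary: bs) (auto simp: Cons_eq_map_conv Inl)
  note * = this Inl
  show ?thesis
    by (cases f) (auto simp: initially_def map_structure_def image_iff *)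
qed

text \<open>
  Slots use the variables below \<open>k\<close>. The variable \<open>k\<close> is an element of the item being read, and
  \<open>k + 1\<close>, \<open>k + 2\<close> are auxiliary.
\<close>

definition previously :: "nat \<Rightarrow> 's fact \<Rightarrow> 'r list_name mso" where
  "previously k f =
     Disj (Conj (first_item k (k + 1)) (truth (initially f)))
       (Ex (k + 1) (Conj (next_item (k + 1) k (k + 2)) (Member (k + 1) (fact_var k f))))"

text \<open>An element of the initial state belongs to no item, whence
  \<open>Falsum\<close>.\<close>

definition here :: "nat \<Rightarrow> slot \<Rightarrow> 'r list_name mso" where
  "here k t = (case t of Inl b \<Rightarrow> Falsum | Inr j \<Rightarrow> same_item j k)"

fun translate_equal :: "slot \<Rightarrow> slot \<Rightarrow> 'r list_name mso" where
  "translate_equal (Inl a) (Inl b) = truth (a = b)"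
| "translate_equal (Inr i) (Inr j) = Equal i j"
| "translate_equal _ _ = Falsum"

text \<open>Atoms on the state are facts from before the item, and \<open>Is_Fst\<close> says that
  the element was alive then. A nullary relation of the item has become unary in the list structure
  and is read off at \<open>k\<close>. The value \<open>k\<close> for \<open>Inl\<close> is a
  default: \<open>here\<close> already rejects such slots.\<close>

fun translate_atom :: "nat \<Rightarrow> ('s, 'r) prod_name \<Rightarrow> slot list \<Rightarrow> 'r list_name mso" where
  "translate_atom k (Fst_Name s) ts = previously k (Rel s ts)"
| "translate_atom k (Snd_Name r) ts =
     (if ts = [] then Atom (Item_Name r) [k]
      else Conj (Conjs (map (here k) ts)) (Atom (Item_Name r) (map (case_sum (\<lambda>_. k) id) ts)))"
| "translate_atom k Is_Fst ts = previously k (Alive (hd ts))"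

text \<open>\<open>\<eta>\<close> gives the slot that each query variable stands for.
  \<open>Member\<close> becomes \<open>Falsum\<close> because \<open>holds\<close> assigns the empty
  set to every set variable.\<close>

primrec translate :: "nat \<Rightarrow> (nat \<Rightarrow> slot) \<Rightarrow> ('s, 'r) prod_name mso \<Rightarrow> 'r list_name mso" where
  "translate k \<eta> Falsum = Falsum"
| "translate k \<eta> (Equal x y) = translate_equal (\<eta> x) (\<eta> y)"
| "translate k \<eta> (Atom p xs) = translate_atom k p (map \<eta> xs)"
| "translate k \<eta> (Member x X) = Falsum"
| "translate k \<eta> (Neg \<phi>) = Neg (translate k \<eta> \<phi>)"
| "translate k \<eta> (Conj \<phi> \<psi>) = Conj (translate k \<eta> \<phi>) (translate k \<eta> \<psi>)"
| "translate k \<eta> (Ex x \<phi>) = Falsum"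
| "translate k \<eta> (ExSet X \<phi>) = Falsum"

text \<open>The first conjunct says that the slot lies in the universe of \<open>joint\<close>: it
  was alive before or belongs to the current item.\<close>

definition survives :: "nat \<Rightarrow> slot \<Rightarrow> 'r list_name mso" where
  "survives k t = Conj (Disj (previously k (Alive t)) (here k t))
     (translate k (\<lambda>_. t) (universe_query I 0))"

primrec step_formula :: "nat \<Rightarrow> 's fact \<Rightarrow> 'r list_name mso" where
  "step_formula k (Alive t) = survives k t"
| "step_formula k (Rel s ts) = Conj (Conjs (map (survives k) ts))
     (translate k (nth ts) (relation_query I s (replicate (length ts) 0)))"

definition fact_list :: "nat \<Rightarrow> 's fact list" where
  "fact_list k = (SOME fs. set fs = facts k)"

lemma set_fact_list [simp]: "set (fact_list k) = facts k"
  unfolding fact_list_def by (rule someI_ex[OF finite_list[OF finite_facts]])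

text \<open>The transition relation of the automaton, imposed at every element of every
  item.\<close>

definition run_formula :: "nat \<Rightarrow> 'r list_name mso" where
  "run_formula k = Forall k (Conjs (map
     (\<lambda>f. Iff (Member k (fact_var k f)) (step_formula k f)) (fact_list k)))"

text \<open>The second disjunct treats the empty list, the only one with an empty universe since
  items are nonempty.\<close>

definition finally_formula :: "nat \<Rightarrow> 's fact \<Rightarrow> 'r list_name mso" where
  "finally_formula k f =
     Disj (Ex k (Conj (last_item k (k + 1)) (Member k (fact_var k f))))
       (Conj (Neg (Ex k (Neg Falsum))) (truth (initially f)))"

definition fact_formula :: "nat \<Rightarrow> 's fact \<Rightarrow> 'r list_name mso" where
  "fact_formula k f =
     ExSets (map (fact_var k) (fact_list k)) (Conj (run_formula k) (finally_formula k f))"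

text \<open>Syntactic invariant of the parts of \<open>run_formula\<close> below its quantifier:
  \<open>k\<close> may still be free, as may the set variables of facts.\<close>

definition local_formula :: "nat \<Rightarrow> 'r list_name mso \<Rightarrow> bool" where
  "local_formula k \<psi> \<longleftrightarrow> over_voc (list_voc v) \<psi> \<and> free_fo \<psi> \<subseteq> {..k} \<and>
     free_so \<psi> \<subseteq> fact_var k ` facts k"

lemma local_formula_connectives [simp]:
  "local_formula k Falsum"
  "local_formula k (truth b)"
  "local_formula k (Neg \<phi>) \<longleftrightarrow> local_formula k \<phi>"
  "local_formula k (Conj \<phi> \<psi>) \<longleftrightarrow> local_formula k \<phi> \<and> local_formula k \<psi>"
  "local_formula k (Conjs \<phi>s) \<longleftrightarrow> (\<forall>\<phi> \<in> set \<phi>s. local_formula k \<phi>)"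
  by (auto simp: local_formula_def)

lemma local_formula_previously: "f \<in> facts k \<Longrightarrow> local_formula k (previously k f)"
  by (auto simp: local_formula_def previously_def item_formula_defs)

lemma local_formula_here: "t \<in> slots k \<Longrightarrow> local_formula k (here k t)"
  by (cases t) (auto simp: local_formula_def here_def item_formula_defs)

lemma local_formula_translate:
  "quantifier_free \<phi> \<Longrightarrow> over_voc (prod_voc w v) \<phi> \<Longrightarrow> (\<And>x. x \<in> free_fo \<phi> \<Longrightarrow> \<eta> x \<in> slots k) \<Longrightarrow>
    local_formula k (translate k \<eta> \<phi>)"
proof (induction \<phi>)
  case (Equal x y)
  then show ?case
    by (cases "\<eta> x"; cases "\<eta> y")
      (auto simp: local_formula_def dest: meta_spec[of _ x] meta_spec[of _ y])
next
  case (Atom p xs)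
  then have \<eta>: "set (map \<eta> xs) \<subseteq> slots k" by auto
  show ?case
  proof (cases p)
    case (Fst_Name s)
    then show ?thesis
      using Atom \<eta> by (auto intro!: local_formula_previously)
  next
    case (Snd_Name r)
    have "case_sum (\<lambda>_. k) id t \<le> k" if "t \<in> slots k" for t
      using that by (cases t) auto
    then have "local_formula k (Atom (Item_Name r) (map (case_sum (\<lambda>_. k) id) (map \<eta> xs)))"
      if "xs \<noteq> []"
      using Atom.prems(2) Snd_Name that \<eta> by (auto simp: local_formula_def)
    moreover have "local_formula k (Atom (Item_Name r) [k])" if "xs = []"
      using Atom.prems(2) Snd_Name that by (auto simp: local_formula_def)
    ultimately show ?thesis
      using Snd_Name \<eta> by (auto intro!: local_formula_here)
  next
    case Is_Fst
    then show ?thesis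
      using Atom.prems(2) \<eta> by (cases xs) (auto intro!: local_formula_previously)
  qed
qed simp_all

lemma local_formula_survives: "t \<in> slots k \<Longrightarrow> local_formula k (survives k t)"
  using formula_universe qf_universe
  by (auto simp: survives_def formula_with_def
      intro!: local_formula_previously local_formula_here local_formula_translate)

lemma local_formula_step: "f \<in> facts k \<Longrightarrow> local_formula k (step_formula k f)"
proof (cases f)
  case (Rel s ts)
  assume "f \<in> facts k"
  then have "w s = Some (length ts)" "set ts \<subseteq> slots k"
    by (auto simp: Rel)
  then show ?thesis
    using formula_relation[of s] qf_relation[of s]
    by (auto simp: Rel formula_with_def
        intro!: local_formula_survives local_formula_translate)
       (meson lessThan_iff nth_mem subset_iff)
qed (simp add: local_formula_survives)

lemma formula_fact_formula:
  assumes "f \<in> facts k"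
  shows "formula_with (list_voc v) k (fact_formula k f)"
proof -
  have step: "over_voc (list_voc v) (step_formula k g)" "free_fo (step_formula k g) \<subseteq> {..k}"
    "free_so (step_formula k g) \<subseteq> fact_var k ` facts k" if "g \<in> facts k" for g
    using local_formula_step[OF that] by (simp_all add: local_formula_def)
  have "x < k" if "x \<in> free_fo (step_formula k g)" "x \<noteq> k" "g \<in> facts k" for x g
    using step(2)[OF that(3)] that by force
  with step(1,3) assms show ?thesis
    by (fastforce simp: formula_with_def fact_formula_def run_formula_def finally_formula_def
        last_item_def before_def)
qed

end


section \<open>Correctness of the formula\<close>

context quantifier_free_fold
begin

context
  fixes As :: "('r, nat) rel_structure list" and k :: nat and val :: "nat \<Rightarrow> nat \<times> nat"
  assumes nonempty: "\<And>A. A \<in> set As \<Longrightarrow> universe A \<noteq> {}"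
    and structures: "\<And>A. A \<in> set As \<Longrightarrow> is_structure v A"
    and val: "\<And>j. j < k \<Longrightarrow> val j \<in> list_universe As"
begin

abbreviation (input) "eval \<equiv> sat (list_structure v As)"

text \<open>At the first item the constant answers. Later, any element of the preceding item can
  serve as witness, because by \<open>prev\<close> all of them agree on the set, and there is
  one.\<close>

lemma sat_previously:
  assumes p: "(i, x) \<in> list_universe As" and f: "f \<in> facts k"
    and prev: "\<And>j y. i = Suc j \<Longrightarrow> (j, y) \<in> list_universe As \<Longrightarrow>
      (j, y) \<in> V (fact_var k f) \<longleftrightarrow> fact_holds (state As i) val f"
  shows "eval (val(k := (i, x))) V (previously k f) \<longleftrightarrow> fact_holds (state As i) val f"
proof -
  let ?val = "val(k := (i, x))"
  have "eval ?val V (previously k f) \<longleftrightarrow> i = 0 \<and> initially f \<or>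
      (\<exists>q \<in> list_universe As. i = Suc (fst q) \<and> q \<in> V (fact_var k f))"
    using p by (simp add: previously_def sat_first_item[OF nonempty] sat_next_item[OF nonempty]
        cong: bex_cong)
  also have "\<dots> \<longleftrightarrow> fact_holds (state As i) val f"
  proof (cases i)
    case 0
    then show ?thesis by (simp add: initially_iff)
  next
    case (Suc j)
    then have "j < length As"
      using p by (simp add: list_universe_def)
    then obtain y where "(j, y) \<in> list_universe As"
      using item_witness[OF nonempty] by blast
    with Suc prev show ?thesis by fastforce
  qed
  finally show ?thesis .
qed

lemma sat_here:
  assumes "(i, x) \<in> list_universe As" "t \<in> slots k"
  shows "eval (val(k := (i, x))) V (here k t) \<longleftrightarrow> map_sum id val t \<in> (\<lambda>y. Inr (i, y)) ` universe (As ! i)"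
proof (cases t)
  case (Inl b)
  then show ?thesis by (auto simp: here_def)
next
  case (Inr j)
  then have j: "j < k" using assms by simp
  then have "val j \<in> list_universe As" by (rule val)
  then show ?thesis
    using assms(1) j by (cases "val j") (auto simp: here_def Inr sat_same_item[OF nonempty] list_universe_def)
qed

context
  fixes i x V
  assumes p: "(i, x) \<in> list_universe As"
    and prev: "\<And>f. f \<in> facts k \<Longrightarrow>
      eval (val(k := (i, x))) V (previously k f) \<longleftrightarrow> fact_holds (state As i) val f"
begin

text \<open>If all slots lie in item \<open>i\<close>, both sides reduce to the same tuple of that
  item; if one does not, both sides are false.\<close>

lemma sat_translate_item_atom:
  assumes r: "v r = Some (length ts)" and ts: "set ts \<subseteq> slots k"
  shows "eval (val(k := (i, x))) V (translate_atom k (Snd_Name r) ts) \<longleftrightarrow>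
    map (map_sum id val) ts \<in> map (\<lambda>x. Inr (i, x)) ` interp (As ! i) r"
proof (cases "ts = []")
  case True
  then show ?thesis
    using r p by (auto simp: list_universe_def)
next
  case False
  have i: "i < length As" and A: "is_structure v (As ! i)"
    using p structures by (auto simp: list_universe_def)
  show ?thesis
  proof (cases "\<forall>t \<in> set ts. eval (val(k := (i, x))) V (here k t)")
    case True
    have "\<exists>y. map_sum id val t = Inr (i, y) \<and> (val(k := (i, x))) (case_sum (\<lambda>_. k) id t) = (i, y)"
      if t: "t \<in> set ts" for t
    proof -
      have "t \<in> slots k" "map_sum id val t \<in> (\<lambda>y. Inr (i, y)) ` universe (As ! i)"
        using True t ts sat_here[OF p] by blast+
      then show ?thesis by (cases t) auto
    qed
    \<comment> \<open>\<open>g\<close> strips the index \<open>i\<close>, which all the entries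
      share.\<close>
    then obtain g where g: "map_sum id val t = Inr (i, g t)"
      "(val(k := (i, x))) (case_sum (\<lambda>_. k) id t) = (i, g t)" if "t \<in> set ts" for t
      by metis
    have "map (map_sum id val) ts = map (\<lambda>x. Inr (i, x)) (map g ts)"
      "map (val(k := (i, x))) (map (case_sum (\<lambda>_. k) id) ts) = map (Pair i) (map g ts)"
      using g by simp_all
    moreover have "map (\<lambda>x. Inr (i, x)) (map g ts) \<in> map (\<lambda>x. Inr (i, x)) ` interp (As ! i) r \<longleftrightarrow>
        map g ts \<in> interp (As ! i) r"
      by (intro inj_image_mem_iff inj_mapI) (simp add: inj_def)
    moreover have "map (Pair i) (map g ts) \<in> list_interp v As (Item_Name r) \<longleftrightarrow>
        map g ts \<in> interp (As ! i) r"
      using list_interp_Item_Name[of v r "map g ts" i As] r False i by simp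
    ultimately have "map (map_sum id val) ts \<in> map (\<lambda>x. Inr (i, x)) ` interp (As ! i) r \<longleftrightarrow>
        map (val(k := (i, x))) (map (case_sum (\<lambda>_. k) id) ts) \<in> list_interp v As (Item_Name r)"
      by (simp only:)
    then show ?thesis
      using True False by (simp del: list_interp.simps map_map fun_upd_apply)
  next
    case no: False
    then obtain t where t: "t \<in> set ts" "\<not> eval (val(k := (i, x))) V (here k t)"
      by blast
    then have "map_sum id val t \<notin> (\<lambda>y. Inr (i, y)) ` universe (As ! i)"
      using sat_here[OF p] ts by blast
    moreover have "set zs \<subseteq> universe (As ! i)" if "zs \<in> interp (As ! i) r" for zs
      using A that by (auto simp: is_structure_def)
    ultimately have "map (map_sum id val) ts \<noteq> map (\<lambda>x. Inr (i, x)) zs"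
      if "zs \<in> interp (As ! i) r" for zs
      using t(1) that by (metis (no_types, lifting) image_eqI image_mono list.set_map subsetD)
    then show ?thesis
      using t False by auto
  qed
qed

lemma sat_translate:
  "quantifier_free \<phi> \<Longrightarrow> over_voc (prod_voc w v) \<phi> \<Longrightarrow>
    (\<And>y. y \<in> free_fo \<phi> \<Longrightarrow> \<eta> y \<in> slots k \<and> env y = map_sum id val (\<eta> y)) \<Longrightarrow>
    eval (val(k := (i, x))) V (translate k \<eta> \<phi>) \<longleftrightarrow>
    sat (joint i (As ! i) (state As i)) env (\<lambda>_. {}) \<phi>"
proof (induction \<phi>)
  case (Equal y z)
  have "y \<in> free_fo (Equal y z :: ('s, 'r) prod_name mso)"
    "z \<in> free_fo (Equal y z :: ('s, 'r) prod_name mso)"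
    by simp_all
  then have "\<eta> y \<in> slots k" "env y = map_sum id val (\<eta> y)"
    "\<eta> z \<in> slots k" "env z = map_sum id val (\<eta> z)"
    using Equal.prems(3) by blast+
  then show ?case
    by (cases "\<eta> y"; cases "\<eta> z") auto
next
  case (Atom q xs)
  have "\<eta> y \<in> slots k \<and> env y = map_sum id val (\<eta> y)" if "y \<in> set xs" for y
    using Atom.prems(3)[unfolded free_fo.simps, OF that] .
  then have \<eta>: "set (map \<eta> xs) \<subseteq> slots k" and env: "map env xs = map (map_sum id val) (map \<eta> xs)"
    by (auto simp only: list.set_map map_map map_eq_conv o_apply)
  show ?case
  proof (cases q)
    case (Fst_Name s)
    then have "Rel s (map \<eta> xs) \<in> facts k"
      using Atom.prems \<eta> by simp
    then have "eval (val(k := (i, x))) V (previously k (Rel s (map \<eta> xs))) \<longleftrightarrow>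
        map (map_sum id val) (map \<eta> xs) \<in> interp (state As i) s"
      by (simp only: prev fact_holds.simps)
    then show ?thesis
      by (simp only: translate.simps translate_atom.simps Fst_Name sat.simps env)
        (simp add: joint_def)
  next
    case (Snd_Name r)
    then have "v r = Some (length (map \<eta> xs))"
      using Atom.prems by simp
    from sat_translate_item_atom[OF this \<eta>] show ?thesis
      by (simp only: translate.simps Snd_Name sat.simps env)
        (simp only: joint_def rel_structure.simps prod_name.simps)
  next
    case Is_Fst
    then obtain y where y: "xs = [y]"
      using Atom.prems(2) by (auto simp: length_Suc_conv dest!: sym[of "Suc 0"])
    with \<eta> have "Alive (\<eta> y) \<in> facts k" by simp
    from prev[OF this] y Is_Fst env show ?thesis
      by (simp add: joint_def del: fun_upd_apply)
  qed
qed simp_all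

lemma sat_survives:
  assumes t: "t \<in> slots k"
  shows "eval (val(k := (i, x))) V (survives k t) \<longleftrightarrow> map_sum id val t \<in> universe (state As (Suc i))"
proof -
  have "eval (val(k := (i, x))) V (translate k (\<lambda>_. t) (universe_query I 0)) \<longleftrightarrow>
      holds (joint i (As ! i) (state As i)) [map_sum id val t] (universe_query I 0)"
    unfolding holds_def using formula_universe qf_universe t
    by (intro sat_translate) (auto simp: formula_with_def)
  moreover have "eval (val(k := (i, x))) V (previously k (Alive t)) \<longleftrightarrow>
      map_sum id val t \<in> universe (state As i)"
    using prev[of "Alive t"] t by simp
  ultimately show ?thesis
    using sat_here[OF p t] by (auto simp: survives_def successor_def survivors_def joint_def)
qed

text \<open>Correctness of a single transition. Of the guessed sets it uses only
  \<open>prev\<close>, that the facts before item \<open>i\<close> are read correctly.\<close>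

lemma sat_step_formula:
  assumes f: "f \<in> facts k"
  shows "eval (val(k := (i, x))) V (step_formula k f) \<longleftrightarrow> fact_holds (state As (Suc i)) val f"
proof (cases f)
  case (Alive t)
  then show ?thesis using f sat_survives[of t] by simp
next
  case (Rel s ts)
  then have s: "w s = Some (length ts)" and ts: "set ts \<subseteq> slots k"
    using f by auto
  have "eval (val(k := (i, x))) V
        (translate k (nth ts) (relation_query I s (replicate (length ts) 0))) \<longleftrightarrow>
      holds (joint i (As ! i) (state As i)) (map (map_sum id val) ts)
        (relation_query I s (replicate (length ts) 0))"
    unfolding holds_def using formula_relation[OF s] qf_relation[OF s] ts
    by (intro sat_translate) (auto simp: formula_with_def subset_iff)
  moreover have "(\<forall>t \<in> set ts. eval (val(k := (i, x))) V (survives k t)) \<longleftrightarrow>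
      map_sum id val ` set ts \<subseteq> universe (state As (Suc i))"
    using sat_survives ts by (auto simp del: state.simps)
  ultimately show ?thesis
    using s by (auto simp: Rel successor_def)
qed

end

section \<open>Existence and uniqueness of the run\<close>

definition correct_run :: "(nat \<Rightarrow> (nat \<times> nat) set) \<Rightarrow> bool" where
  "correct_run V \<longleftrightarrow> (\<forall>(i, x) \<in> list_universe As. \<forall>f \<in> facts k.
     (i, x) \<in> V (fact_var k f) \<longleftrightarrow> fact_holds (state As (Suc i)) val f)"

text \<open>The automaton is deterministic: by induction on the item index, sets obeying the
  transitions must agree with the true states.\<close>

lemma sat_run_formula: "eval val V (run_formula k) \<longleftrightarrow> correct_run V"
proof -
  \<comment> \<open>The hypothesis on item \<open>j\<close> is void for \<open>i = 0\<close>; this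
    starts the induction below.\<close>
  have step: "eval (val(k := (i, x))) V (step_formula k f) \<longleftrightarrow> fact_holds (state As (Suc i)) val f"
    if p: "(i, x) \<in> list_universe As" and f: "f \<in> facts k"
      and "\<And>j y g. i = Suc j \<Longrightarrow> (j, y) \<in> list_universe As \<Longrightarrow> g \<in> facts k \<Longrightarrow>
        (j, y) \<in> V (fact_var k g) \<longleftrightarrow> fact_holds (state As i) val g" for i x f
    using that by (intro sat_step_formula sat_previously) auto
  have run: "eval val V (run_formula k) \<longleftrightarrow> (\<forall>(i, x) \<in> list_universe As. \<forall>f \<in> facts k.
      (i, x) \<in> V (fact_var k f) \<longleftrightarrow> eval (val(k := (i, x))) V (step_formula k f))"
    by (auto simp: run_formula_def)
  show ?thesis
  proof
    assume correct: "correct_run V"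
    then show "eval val V (run_formula k)"
      unfolding run using step by (fastforce simp: correct_run_def simp del: state.simps)
  next
    assume "eval val V (run_formula k)"
    then have V: "(i, x) \<in> V (fact_var k f) \<longleftrightarrow> eval (val(k := (i, x))) V (step_formula k f)"
      if "(i, x) \<in> list_universe As" "f \<in> facts k" for i x f
      using that unfolding run by blast
    have "(i, x) \<in> V (fact_var k f) \<longleftrightarrow> fact_holds (state As (Suc i)) val f"
      if "(i, x) \<in> list_universe As" "f \<in> facts k" for i x f
      using that
    proof (induction i arbitrary: x f)
      case 0
      then show ?case using V step by blast
    next
      case (Suc i)
      then show ?case
        using V step[of "Suc i" x f] by (metis nat.inject)
    qed
    then show "correct_run V"
      unfolding correct_run_def by blast
  qed
qed

lemma sat_finally_formula:
  assumes V: "correct_run V" and f: "f \<in> facts k"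
  shows "eval val V (finally_formula k f) \<longleftrightarrow> fact_holds (state As (length As)) val f"
proof -
  have "eval val V (finally_formula k f) \<longleftrightarrow>
      (\<exists>p \<in> list_universe As. Suc (fst p) = length As \<and> p \<in> V (fact_var k f)) \<or>
      list_universe As = {} \<and> initially f"
    by (auto simp: finally_formula_def sat_last_item[OF nonempty] cong: bex_cong)
  also have "\<dots> \<longleftrightarrow> fact_holds (state As (length As)) val f"
  proof (cases "length As")
    case 0
    then show ?thesis by (auto simp: list_universe_def initially_iff)
  next
    case (Suc n)
    then obtain x where x: "(n, x) \<in> list_universe As"
      using item_witness[of As n] nonempty by auto
    have "(n, y) \<in> V (fact_var k f) \<longleftrightarrow> fact_holds (state As (length As)) val f"
      if "(n, y) \<in> list_universe As" for y
      using V f that unfolding correct_run_def Suc by blast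
    with x Suc show ?thesis by fastforce
  qed
  finally show ?thesis .
qed

text \<open>Every correct guess gives the same answer, so it remains only to see that one
  exists.\<close>

lemma sat_fact_formula:
  assumes f: "f \<in> facts k"
  shows "eval val V (fact_formula k f) \<longleftrightarrow> fact_holds (state As (length As)) val f"
proof -
  let ?Xs = "map (fact_var k) (fact_list k)"
  define run where "run W = (\<lambda>X. if X \<in> set ?Xs then W X else V X)" for W
  have "eval val V (fact_formula k f) \<longleftrightarrow> (\<exists>W. (\<forall>X. W X \<subseteq> list_universe As) \<and>
      correct_run (run W) \<and> eval val (run W) (finally_formula k f))"
    by (simp add: fact_formula_def sat_ExSets sat_run_formula run_def del: set_map)
  also have "\<dots> \<longleftrightarrow> (\<exists>W. (\<forall>X. W X \<subseteq> list_universe As) \<and> correct_run (run W)) \<and>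
      fact_holds (state As (length As)) val f"
    using sat_finally_formula[OF _ f] by blast
  finally have "eval val V (fact_formula k f) \<longleftrightarrow>
      (\<exists>W. (\<forall>X. W X \<subseteq> list_universe As) \<and> correct_run (run W)) \<and>
      fact_holds (state As (length As)) val f" .
  moreover have "\<exists>W. (\<forall>X. W X \<subseteq> list_universe As) \<and> correct_run (run W)"
  proof (intro exI conjI allI)
    \<comment> \<open>The true run. Injectivity of \<open>fact_var\<close> ensures that
      \<open>X\<close> belongs to at most one fact \<open>g\<close>.\<close>
    let ?W = "\<lambda>X. {p \<in> list_universe As. \<exists>g \<in> facts k. fact_var k g = X \<and>
      fact_holds (state As (Suc (fst p))) val g}"
    show "?W X \<subseteq> list_universe As" for X by blast
    show "correct_run (run ?W)"
      unfolding correct_run_def run_def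
      using inj_on_eq_iff[OF inj_fact_var] by (auto simp del: state.simps)
  qed
  ultimately show ?thesis by simp
qed

end

end


section \<open>The interpretation\<close>

context quantifier_free_fold
begin

text \<open>Decodes a component of a power of \<open>fold_functor\<close>: \<open>0\<close> consumes
  the next free variable, counted by \<open>j\<close>, and \<open>Suc b\<close> consumes
  none.\<close>

primrec entries :: "nat \<Rightarrow> nat list \<Rightarrow> slot list" where
  "entries j [] = []"
| "entries j (c # cs) =
     (case c of 0 \<Rightarrow> Inr j # entries (Suc j) cs | Suc b \<Rightarrow> Inl b # entries j cs)"

text \<open>Component \<open>0\<close> holds input elements; the shift by \<open>Suc\<close> keeps
  it apart from the constants for the elements of \<open>B0\<close>.\<close>

definition fold_functor :: "nat poly_functor" where
  "fold_functor =
     \<lparr>components = insert 0 (Suc ` universe B0), dimension = (\<lambda>c. if c = 0 then 1 else 0)\<rparr>"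

text \<open>The first argument of \<open>fact_formula\<close> is the dimension of the component,
  that is, the number of input elements in the tuple.\<close>

definition fold_interp :: "('r list_name, 's) mso_interp" where
  "fold_interp =
     \<lparr>ifunctor = fold_functor,
      universe_query = (\<lambda>c. fact_formula (dimension fold_functor c) (Alive (hd (entries 0 [c])))),
      relation_query = (\<lambda>s cs. fact_formula (dimension (functor_power fold_functor (length cs)) cs)
        (Rel s (entries 0 cs)))\<rparr>"

lemma length_entries [simp]: "length (entries j cs) = length cs"
  by (induction cs arbitrary: j) (auto split: nat.split)

lemma entries_slots:
  assumes "set cs \<subseteq> components fold_functor"
    "j + sum_list (map (dimension fold_functor) cs) \<le> k"
  shows "set (entries j cs) \<subseteq> slots k"
  using assms
proof (induction cs arbitrary: j)
  case (Cons c cs)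
  then show ?case
    using Cons.IH[of j] Cons.IH[of "Suc j"] by (cases c) (auto simp: fold_functor_def)
qed simp

lemma is_interpretation_fold_interp: "is_interpretation (list_voc v) w fold_interp"
  unfolding is_interpretation_def is_query_def
proof (intro conjI ballI allI impI)
  show "finite (components (ifunctor fold_interp))"
    using initial by (simp add: fold_interp_def fold_functor_def is_structure_def)
next
  fix c assume "c \<in> components (ifunctor fold_interp)"
  then have "set (entries 0 [c]) \<subseteq> slots (dimension fold_functor c)"
    by (intro entries_slots) (simp_all add: fold_interp_def)
  then show "formula_with (list_voc v) (dimension (ifunctor fold_interp) c)
      (universe_query fold_interp c)"
    by (auto simp: fold_interp_def split: nat.splits intro!: formula_fact_formula)
next
  fix s m cs
  assume s: "w s = Some m" and "cs \<in> components (functor_power (ifunctor fold_interp) m)"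
  then have cs: "length cs = m" "set cs \<subseteq> components fold_functor"
    by (auto simp: functor_power_def fold_interp_def)
  have "set (entries 0 cs) \<subseteq> slots (sum_list (map (dimension fold_functor) cs))"
    using cs by (intro entries_slots) simp_all
  with s cs show "formula_with (list_voc v) (dimension (functor_power (ifunctor fold_interp) m) cs)
      (relation_query fold_interp s cs)"
    by (auto simp: fold_interp_def functor_power_def intro!: formula_fact_formula)
qed

definition encode :: "nat + 'p \<Rightarrow> nat \<times> 'p list" where
  "encode t = (case t of Inl b \<Rightarrow> (Suc b, []) | Inr p \<Rightarrow> (0, [p]))"

lemma inj_encode: "inj encode"
  by (auto simp: inj_def encode_def split: sum.splits)

text \<open>Decoding inverts encoding. The prefix \<open>ps\<close> of values already consumed
  generalizes the claim for induction, its length being the next variable.\<close>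

lemma entries_encode:
  "map (map_sum id (nth (ps @ snd (flatten (map encode ts)))))
     (entries (length ps) (fst (flatten (map encode ts)))) = ts"
proof (induction ts arbitrary: ps)
  case (Cons t ts)
  show ?case
  proof (cases t)
    case (Inl b)
    then show ?thesis
      using Cons[of ps] by (simp add: encode_def flatten_def)
  next
    case (Inr p)
    then show ?thesis
      using Cons[of "ps @ [p]"] by (simp add: encode_def flatten_def)
  qed
qed (simp add: flatten_def)

lemma interpreted_fold_interp:
  assumes nonempty: "\<And>A. A \<in> set As \<Longrightarrow> universe A \<noteq> {}"
    and structures: "\<And>A. A \<in> set As \<Longrightarrow> is_structure v A"
  shows "state As (length As) \<cong> interpreted w fold_interp (list_structure v As)"
proof -
  let ?C = "state As (length As)" and ?L = "list_structure v As"
  let ?U = "query_result fold_functor (universe_query fold_interp) ?L"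
  \<comment> \<open>All elements that could be alive at the end.\<close>
  let ?D = "Inl ` universe B0 \<union> Inr ` list_universe As"
  have C: "universe ?C \<subseteq> ?D"
    using state_universe[of As "length As"] by (auto simp: list_universe_def)
  have flat: "set ts \<subseteq> ?D \<Longrightarrow> flatten (map encode ts) \<in>
      functor_apply (functor_power fold_functor (length ts)) (list_universe As)" for ts
    by (induction ts)
      (auto simp: flatten_def functor_apply_def functor_power_def fold_functor_def encode_def)
  have formula: "holds ?L (snd (flatten (map encode ts)))
        (fact_formula (length (snd (flatten (map encode ts)))) f) \<longleftrightarrow>
      fact_holds ?C (nth (snd (flatten (map encode ts)))) f"
    if "set ts \<subseteq> ?D" "f \<in> facts (length (snd (flatten (map encode ts))))" for ts f
    unfolding holds_def
  proof (rule sat_fact_formula[OF nonempty structures])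
    show "snd (flatten (map encode ts)) ! j \<in> list_universe As"
      if "j < length (snd (flatten (map encode ts)))" for j
      using flat[OF \<open>set ts \<subseteq> ?D\<close>] nth_mem[OF that] by (auto simp: functor_apply_def)
  qed (use that in simp_all)
  have rel: "flatten (map encode ts) \<in>
        query_result (functor_power fold_functor (length ts)) (relation_query fold_interp s) ?L \<longleftrightarrow>
      ts \<in> interp ?C s" if ts: "set ts \<subseteq> ?D" and s: "w s = Some (length ts)" for ts s
  proof -
    obtain cs ps where fl: "flatten (map encode ts) = (cs, ps)"
      by (cases "flatten (map encode ts)")
    have cs: "length cs = length ts" "set cs \<subseteq> components fold_functor"
      "sum_list (map (dimension fold_functor) cs) = length ps"
      using flat[OF ts] fl by (auto simp: functor_apply_def functor_power_def)
    have "set (entries 0 cs) \<subseteq> slots (length ps)"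
      using cs by (intro entries_slots) simp_all
    with s cs(1) have "Rel s (entries 0 cs) \<in> facts (length ps)" by simp
    from formula[OF ts, unfolded fl snd_conv, OF this]
    \<comment> \<open>With empty prefix, \<open>entries_encode\<close> turns the slots back into
      \<open>ts\<close>.\<close>
    have "holds ?L ps (fact_formula (length ps) (Rel s (entries 0 cs))) \<longleftrightarrow> ts \<in> interp ?C s"
      using entries_encode[of "[]" ts] by (simp add: fl)
    then show ?thesis
      using flat[OF ts] cs
      by (simp add: fl query_result_def fold_interp_def functor_power_def)
  qed
  have univ: "encode t \<in> ?U \<longleftrightarrow> t \<in> universe ?C" if t: "t \<in> ?D" for t
  proof -
    obtain c ps where e: "encode t = (c, ps)"
      by (cases "encode t")
    then have fl: "flatten (map encode [t]) = ([c], ps)"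
      by (simp add: flatten_def)
    have c: "c \<in> components fold_functor" "dimension fold_functor c = length ps"
      "set ps \<subseteq> list_universe As"
      using flat[of "[t]"] t fl by (auto simp: functor_apply_def functor_power_def)
    have "set (entries 0 [c]) \<subseteq> slots (length ps)"
      using c by (intro entries_slots) simp_all
    then have "Alive (hd (entries 0 [c])) \<in> facts (length ps)"
      by (simp split: nat.splits)
    from formula[of "[t]", unfolded fl snd_conv, OF _ this]
    have "holds ?L ps (fact_formula (length ps) (Alive (hd (entries 0 [c])))) \<longleftrightarrow> t \<in> universe ?C"
      using t entries_encode[of "[]" "[t]"] unfolding fl by (simp split: nat.splits)
    then show ?thesis
      using c by (simp add: e query_result_def fold_interp_def functor_apply_def)
  qed
  \<comment> \<open>Surjectivity: the functor contains nothing but codes of elements of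
    \<open>?D\<close>.\<close>
  have range: "?U \<subseteq> encode ` ?D"
  proof
    fix e assume "e \<in> ?U"
    then have "e \<in> functor_apply fold_functor (list_universe As)"
      by (auto simp: query_result_def)
    then obtain c ps where "e = (c, ps)" "c = 0 \<and> (\<exists>p \<in> list_universe As. ps = [p]) \<or>
        (\<exists>b \<in> universe B0. c = Suc b \<and> ps = [])"
      by (cases e) (auto simp: functor_apply_def fold_functor_def length_Suc_conv)
    then show "e \<in> encode ` ?D"
      by (force simp: encode_def image_iff)
  qed
  have U: "?U = encode ` universe ?C"
    using univ range C by auto
  have "is_structure w ?C"
    using structures by (intro is_structure_state) (auto simp: is_structure_def)
  \<comment> \<open>\<open>interpreted\<close> builds in the arity condition, so the state must
    satisfy it too.\<close>
  then have arity: "w s = Some (length ts)" if "ts \<in> interp ?C s" for s ts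
    using that by (simp add: is_structure_def)
  show ?thesis
    unfolding isomorphic_iff iso_map_def
  proof (intro exI[of _ encode] conjI allI impI)
    show "bij_betw encode (universe ?C) (universe (interpreted w fold_interp ?L))"
      using U inj_on_subset[OF inj_encode]
      by (simp add: bij_betw_def interpreted_def Let_def fold_interp_def)
    fix s ts
    assume "set ts \<subseteq> universe ?C"
    then show "ts \<in> interp ?C s \<longleftrightarrow> map encode ts \<in> interp (interpreted w fold_interp ?L) s"
      using rel[of ts s] arity[of ts s] C U
      by (auto simp: interpreted_def Let_def fold_interp_def)
  qed
qed

end

theorem theorem1:
  fixes \<Sigma> :: "'r struct_class" and \<Gamma> :: "'s struct_class"
    and B0 :: "('s, nat) rel_structure"
    and \<delta> :: "(('s, 'r) prod_name, nat) rel_structure \<Rightarrow> ('s, nat) rel_structure"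
  assumes "is_class \<Sigma>" and "is_class \<Gamma>"
    and "B0 \<in> members \<Gamma>"
    and "quantifier_free_interpretation (prod_class \<Gamma> \<Sigma>) \<Gamma> \<delta>"
  shows "linear_mso_interpretation (list_class \<Sigma>) \<Gamma> (fold_function \<Sigma> \<delta> B0)"
proof -
  obtain I where I: "realizes I (prod_class \<Gamma> \<Sigma>) \<Gamma> \<delta>" "ifunctor I = id_functor"
    "\<forall>i \<in> components id_functor. quantifier_free (universe_query I i)"
    "\<forall>s m. voc \<Gamma> s = Some m \<longrightarrow>
      (\<forall>cs \<in> components (functor_power id_functor m). quantifier_free (relation_query I s cs))"
    using assms(4) unfolding quantifier_free_interpretation_def by blast
  interpret quantifier_free_fold "voc \<Sigma>" "voc \<Gamma>" B0 I
  proof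
    show "finite (dom (voc \<Gamma>))"
      using assms(2) by (simp add: is_class_def)
    show "is_structure (voc \<Gamma>) B0"
      using assms(2,3) by (rule is_class_structure)
    show "is_interpretation (prod_voc (voc \<Gamma>) (voc \<Sigma>)) (voc \<Gamma>) I"
      using I(1) by (simp add: realizes_def prod_class_def)
    show "quantifier_free (universe_query I 0)"
      using I(3) by (simp add: id_functor_def)
    show "quantifier_free (relation_query I s (replicate m 0))" if "voc \<Gamma> s = Some m" for s m
    proof -
      have "replicate m 0 \<in> components (functor_power id_functor m)"
        by (auto simp: functor_power_def id_functor_def)
      with I(4) that show ?thesis by blast
    qed
  qed (fact I(2))
  have fold: "fold_list \<delta> B0 As \<in> members \<Gamma>" "fold_list \<delta> B0 As \<cong> state As (length As)"
    if "item_list \<Sigma> As" for As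
    using fold_list_state[OF assms(1) refl assms(2) refl I(1) assms(3) that, of "length As"]
    by simp_all
  have "fold_function \<Sigma> \<delta> B0 S \<in> members \<Gamma> \<and>
      fold_function \<Sigma> \<delta> B0 S \<cong> interpreted (voc \<Gamma>) fold_interp S"
    if S: "S \<in> members (list_class \<Sigma>)" for S
  proof
    obtain As where As: "item_list \<Sigma> As" "list_structure (voc \<Sigma>) As \<cong> S"
      using S by (auto simp: list_class_def)
    \<comment> \<open>\<open>fold_function\<close> folds a chosen list, which need not be
      \<open>As\<close>; membership in \<open>\<Gamma>\<close> is shown for the chosen one.\<close>
    have "item_list \<Sigma> (SOME As. item_list \<Sigma> As \<and> list_structure (voc \<Sigma>) As \<cong> S)"
      using someI[where P = "\<lambda>As. item_list \<Sigma> As \<and> list_structure (voc \<Sigma>) As \<cong> S", OF conjI[OF As]]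
      by blast
    then show "fold_function \<Sigma> \<delta> B0 S \<in> members \<Gamma>"
      unfolding fold_function_def by (rule fold(1))
    \<comment> \<open>Well-definedness of the fold allows passing to \<open>As\<close>, where the
      formulas were analysed; isomorphism invariance leads back to \<open>S\<close>.\<close>
    have "fold_function \<Sigma> \<delta> B0 S \<cong> fold_list \<delta> B0 As"
      using assms As by (intro fold_function_list)
    also have "\<dots> \<cong> state As (length As)"
      using As(1) by (rule fold(2))
    also have "state As (length As) \<cong> interpreted (voc \<Gamma>) fold_interp (list_structure (voc \<Sigma>) As)"
      using As(1) is_class_structure[OF assms(1)]
      by (intro interpreted_fold_interp) (auto simp: item_list_def)
    also have "\<dots> \<cong> interpreted (voc \<Gamma>) fold_interp S"
      using As(2) is_interpretation_fold_interp by (rule interpreted_isomorphic)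
    finally show "fold_function \<Sigma> \<delta> B0 S \<cong> interpreted (voc \<Gamma>) fold_interp S" .
  qed
  then have "realizes fold_interp (list_class \<Sigma>) \<Gamma> (fold_function \<Sigma> \<delta> B0)"
    using is_interpretation_fold_interp by (simp add: realizes_def list_class_def)
  moreover have "\<forall>i \<in> components (ifunctor fold_interp). dimension (ifunctor fold_interp) i \<le> 1"
    by (simp add: fold_interp_def fold_functor_def)
  ultimately show ?thesis
    unfolding linear_mso_interpretation_def by blast
qed

end
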